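(* Let $m\ge2$, $n\ge1$, $q>m/2$, $0<\lambda\le\Lambda<\infty$, $\gamma_0\in(0,1]$ with $\gamma_0>\frac{m-2}{2}$, and let $B_1\subset\mathbb{R}^m$ be the open unit ball. Let $\mathcal{S}$ be a class of quadruples $$(\boldsymbol{u},\boldsymbol{\Omega},\boldsymbol{f},A)\in\big(H^1\cap L^\infty(B_1,\mathbb{R}^{n+1})\big)\times L^2(B_1,\mathbb{R}^{(n+1)\times(n+1)}\otimes\mathbb{R}^m)\times L^q(B_1,\mathbb{R}^{n+1})\times C^{0,\gamma_0}(\overline{B_1},\mathbb{R}^{m\times m}_{\mathrm{sym}}),$$ where $A$ is uniformly elliptic with constants $\lambda,\Lambda$ and $\mathbf{div}\,\boldsymbol{\Omega}\in L^q(B_1)$, satisfying: (Closure) if $(\boldsymbol{u},\boldsymbol{\Omega},\boldsymbol{f},A)\in\mathcal{S}$ and $B_r(x_0)\subset B_1$, then the rescaled quadruple given for $y\in B_1$ by $\boldsymbol{u}(x_0+ry)$, $r\,\boldsymbol{\Omega}(x_0+ry)$, $r^2\boldsymbol{f}(x_0+ry)$, $A(x_0+ry)$ belongs to $\mathcal{S}$; (Decay) there exist constants $\theta,\gamma\in(0,1)$, $p\ge1$, $M>0$, $\kappa>0$ such that for every $(\boldsymbol{u},\boldsymbol{\Omega},\boldsymbol{f},A)\in\mathcal{S}$ with $\|\boldsymbol{u}\|_{L^\infty(B_1)}\le M$, $$\Psi_p(\boldsymbol{u},B_\theta)\le\gamma\,\Psi_p(\boldsymbol{u},B_1)+\kappa\big(D_{\mathrm{src}}^p+D_{\mathrm{frz}}^p\big),$$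 where $D_{\mathrm{src}}:=\|\boldsymbol{f}\|_{L^q(B_1)}+M\|\mathbf{div}\,\boldsymbol{\Omega}\|_{L^q(B_1)}$ and $D_{\mathrm{frz}}:=\|A-A(0)\|_{L^\infty(B_1)}\|\nabla\boldsymbol{u}\|_{L^2(B_1)}$. If $(\boldsymbol{u},\boldsymbol{\Omega},\boldsymbol{f},A)\in\mathcal{S}$ with $\|\boldsymbol{u}\|_{L^\infty(B_1)}\le M$, then $\boldsymbol{u}$ is locally Hölder continuous in $B_1$: $\boldsymbol{u}\in C^{0,\eta}_{\mathrm{loc}}(B_1)$ for every Hölder exponent $\eta\in(0,1)$ with $$\eta<\min\Big(\frac{\ln\gamma}{p\ln\theta},\;2-\frac mq,\;\gamma_0+\frac{2-m}{2}\Big).$$ For any compact $K\subset B_1$, the Hölder seminorm of $\boldsymbol u$ on $K$ depends only on $\eta$, $\theta,\gamma,\kappa,p,M$, the norms $\|\mathbf{div}\,\boldsymbol{\Omega}\|_{L^q(B_1)}$, $\|\boldsymbol{f}\|_{L^q(B_1)}$, $\|\nabla\boldsymbol{u}\|_{L^2(B_1)}$, $[A]_{C^{0,\gamma_0}(\overline{B_1})}$, and $\mathrm{dist}(K,\partial B_1)$ (i.e. it is bounded by a constant depending only on these quantities, for the fixed $m,n,q,\gamma_0,\lambda,\Lambda$).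
   Context: $B_r(x_0)$ is the open ball, $B_r=B_r(0)$. For a ball $B$ and $p\ge1$, the $L^p$-oscillation is $\Psi_p(\boldsymbol v,B):=\inf_{\boldsymbol c\in\mathbb{R}^{n+1}}\frac1{|B|}\int_B|\boldsymbol v(y)-\boldsymbol c|^p\,\mathrm{d}y$. $\boldsymbol\Omega=(\Omega^{\alpha\beta})$ is a matrix of $\mathbb{R}^m$-valued vector fields and $\mathbf{div}\,\boldsymbol\Omega$ the matrix of distributional divergences $\operatorname{div}\Omega^{\alpha\beta}$. Uniform ellipticity: $\lambda|\xi|^2\le A(x)\xi\cdot\xi\le\Lambda|\xi|^2$ for all $x,\xi$. $[A]_{C^{0,\gamma_0}}$ is the Hölder seminorm. Continuity refers to a suitable a.e. representative. *)

theory Defs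
  imports "HOL-Analysis.Analysis" "HOL-Probability.Essential_Supremum"
begin

section \<open>Lebesgue spaces\<close>

text \<open>Matrices and matrices of vectors carry the Euclidean (Frobenius) norm of the nested
  vector types. An element of a Lebesgue space over \<open>U\<close> is represented by a total function
  whose values outside \<open>U\<close> are irrelevant.\<close>

definition Lp_space :: "real \<Rightarrow> 'a::euclidean_space set \<Rightarrow> ('a \<Rightarrow> 'b::euclidean_space) set"
  where "Lp_space p U = {f \<in> borel_measurable (lebesgue_on U).
           integrable (lebesgue_on U) (\<lambda>x. norm (f x) powr p)}"

definition Lp_norm :: "real \<Rightarrow> 'a::euclidean_space set \<Rightarrow> ('a \<Rightarrow> 'b::euclidean_space) \<Rightarrow> real"
  where "Lp_norm p U f = (\<integral>x. norm (f x) powr p \<partial>lebesgue_on U) powr (1 / p)"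

definition Linf_space :: "'a::euclidean_space set \<Rightarrow> ('a \<Rightarrow> 'b::euclidean_space) set"
  where "Linf_space U = {f \<in> borel_measurable (lebesgue_on U).
           esssup (lebesgue_on U) (\<lambda>x. ereal (norm (f x))) < \<infinity>}"

definition Linf_norm :: "'a::euclidean_space set \<Rightarrow> ('a \<Rightarrow> 'b::euclidean_space) \<Rightarrow> real"
  where "Linf_norm U f = real_of_ereal (esssup (lebesgue_on U) (\<lambda>x. ereal (norm (f x))))"

definition oscillation ::
    "real \<Rightarrow> ('a::euclidean_space \<Rightarrow> 'b::euclidean_space) \<Rightarrow> 'a set \<Rightarrow> real"
  where "oscillation p v B =
    (INF c. 1 / measure lebesgue B * (\<integral>y. norm (v y - c) powr p \<partial>lebesgue_on B))"


section \<open>Test functions and distributional derivatives\<close>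

definition partial_deriv :: "'m \<Rightarrow> (real^'m \<Rightarrow> real) \<Rightarrow> real^'m \<Rightarrow> real"
  where "partial_deriv i \<phi> x = frechet_derivative \<phi> (at x) (axis i 1)"

primrec C_k :: "nat \<Rightarrow> (real^'m \<Rightarrow> real) \<Rightarrow> bool" where
  "C_k 0 \<phi> \<longleftrightarrow> continuous_on UNIV \<phi>"
| "C_k (Suc k) \<phi> \<longleftrightarrow> (\<forall>x. \<phi> differentiable (at x)) \<and> (\<forall>i. C_k k (partial_deriv i \<phi>))"

definition test_functions :: "(real^'m) set \<Rightarrow> (real^'m \<Rightarrow> real) set"
  where "test_functions U = {\<phi>. (\<forall>k. C_k k \<phi>) \<and>
           compact (closure {x. \<phi> x \<noteq> 0}) \<and> closure {x. \<phi> x \<noteq> 0} \<subseteq> U}"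

text \<open>Distributional derivatives are a.e.\ unique, so they are treated as relations between a
  function and (a representative of) its derivative. The integrability requirement on the
  derivative is part of the relation, so that the integrals below exist for all arguments of
  interest. In \<open>G\<close>, the entry \<open>G x $ a $ i\<close> is the derivative of the \<open>a\<close>-th component in
  direction \<open>i\<close>; the divergence of a matrix of vector fields is taken entrywise.\<close>

definition has_L2_gradient :: "(real^'m \<Rightarrow> real^'k) \<Rightarrow> (real^'m \<Rightarrow> real^'m^'k) \<Rightarrow> (real^'m) set \<Rightarrow> bool"
  where "has_L2_gradient u G U \<longleftrightarrow> G \<in> Lp_space 2 U \<and>
    (\<forall>\<phi>\<in>test_functions U. \<forall>a i.
       (\<integral>x. u x $ a * partial_deriv i \<phi> x \<partial>lebesgue_on U)
         = - (\<integral>x. G x $ a $ i * \<phi> x \<partial>lebesgue_on U))"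

definition has_Lq_divergence ::
    "real \<Rightarrow> (real^'m \<Rightarrow> (real^'m)^'k^'k) \<Rightarrow> (real^'m \<Rightarrow> real^'k^'k) \<Rightarrow> (real^'m) set \<Rightarrow> bool"
  where "has_Lq_divergence q \<Omega> d U \<longleftrightarrow> d \<in> Lp_space q U \<and>
    (\<forall>\<phi>\<in>test_functions U. \<forall>a b.
       (\<integral>x. (\<Omega> x $ a $ b) \<bullet> (\<chi> i. partial_deriv i \<phi> x) \<partial>lebesgue_on U)
         = - (\<integral>x. d x $ a $ b * \<phi> x \<partial>lebesgue_on U))"

definition H1_space :: "(real^'m) set \<Rightarrow> (real^'m \<Rightarrow> real^'k) set"
  where "H1_space U = {u \<in> Lp_space 2 U. \<exists>G. has_L2_gradient u G U}"


section \<open>Hoelder spaces\<close>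

text \<open>The pairs with \<open>x = y\<close> contribute \<open>0 / 0 = 0\<close>.\<close>

definition holder_seminorm :: "real \<Rightarrow> 'a::metric_space set \<Rightarrow> ('a \<Rightarrow> 'b::metric_space) \<Rightarrow> ennreal"
  where "holder_seminorm \<eta> K f =
    (SUP x\<in>K. SUP y\<in>K. ennreal (dist (f x) (f y) / dist x y powr \<eta>))"

definition locally_holder :: "real \<Rightarrow> 'a::metric_space set \<Rightarrow> ('a \<Rightarrow> 'b::metric_space) \<Rightarrow> bool"
  where "locally_holder \<eta> U f \<longleftrightarrow> (\<forall>K. compact K \<and> K \<subseteq> U \<longrightarrow> holder_seminorm \<eta> K f < \<infinity>)"


section \<open>Classes of quadruples\<close>

type_synonym ('m, 'k) quadruple =
  "(real^'m \<Rightarrow> real^'k) \<times> (real^'m \<Rightarrow> (real^'m)^'k^'k) \<times> (real^'m \<Rightarrow> real^'k) \<times> (real^'m \<Rightarrow> real^'m^'m)"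

definition uniformly_elliptic :: "real \<Rightarrow> real \<Rightarrow> (real^'m) set \<Rightarrow> (real^'m \<Rightarrow> real^'m^'m) \<Rightarrow> bool"
  where "uniformly_elliptic ell \<Lambda> X A \<longleftrightarrow>
    (\<forall>x\<in>X. \<forall>\<xi>. ell * (norm \<xi>)\<^sup>2 \<le> (A x *v \<xi>) \<bullet> \<xi> \<and> (A x *v \<xi>) \<bullet> \<xi> \<le> \<Lambda> * (norm \<xi>)\<^sup>2)"

definition admissible_quadruples ::
    "real \<Rightarrow> real \<Rightarrow> real \<Rightarrow> real \<Rightarrow> ('m::finite, 'k::finite) quadruple set"
  where "admissible_quadruples q ell \<Lambda> \<gamma>\<^sub>0 = {(u, \<Omega>, f, A).
    u \<in> H1_space (ball 0 1) \<inter> Linf_space (ball 0 1) \<and>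
    \<Omega> \<in> Lp_space 2 (ball 0 1) \<and>
    (\<exists>d. has_Lq_divergence q \<Omega> d (ball 0 1)) \<and>
    f \<in> Lp_space q (ball 0 1) \<and>
    holder_seminorm \<gamma>\<^sub>0 (cball 0 1) A < \<infinity> \<and>
    (\<forall>x\<in>cball 0 1. transpose (A x) = A x) \<and>
    uniformly_elliptic ell \<Lambda> (cball 0 1) A}"

definition rescale ::
    "real^'m \<Rightarrow> real \<Rightarrow> ('m::finite, 'k::finite) quadruple \<Rightarrow> ('m, 'k) quadruple"
  where "rescale x\<^sub>0 r = (\<lambda>(u, \<Omega>, f, A).
    (\<lambda>y. u (x\<^sub>0 + r *\<^sub>R y), \<lambda>y. r *\<^sub>R \<Omega> (x\<^sub>0 + r *\<^sub>R y),
     \<lambda>y. r\<^sup>2 *\<^sub>R f (x\<^sub>0 + r *\<^sub>R y), \<lambda>y. A (x\<^sub>0 + r *\<^sub>R y)))"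

text \<open>Two quadruples of total functions represent the same quadruple on the unit ball if the
  components in Lebesgue spaces agree a.e.\ there and the continuous coefficients agree on the
  closed ball. Membership of a quadruple in a class is understood modulo this relation.\<close>

definition same_quadruple :: "('m::finite, 'k::finite) quadruple \<Rightarrow> ('m, 'k) quadruple \<Rightarrow> bool"
  where "same_quadruple = (\<lambda>(u, \<Omega>, f, A) (u', \<Omega>', f', A').
    (AE x in lebesgue_on (ball 0 1). u x = u' x) \<and>
    (AE x in lebesgue_on (ball 0 1). \<Omega> x = \<Omega>' x) \<and>
    (AE x in lebesgue_on (ball 0 1). f x = f' x) \<and>
    (\<forall>x\<in>cball 0 1. A x = A' x))"

definition closed_under_rescaling :: "('m::finite, 'k::finite) quadruple set \<Rightarrow> bool"
  where "closed_under_rescaling S \<longleftrightarrow>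
    (\<forall>Q\<in>S. \<forall>x\<^sub>0 r. r > 0 \<and> ball x\<^sub>0 r \<subseteq> ball 0 1 \<longrightarrow>
       (\<exists>Q'\<in>S. same_quadruple (rescale x\<^sub>0 r Q) Q'))"

definition oscillation_decay ::
    "real \<Rightarrow> real \<Rightarrow> real \<Rightarrow> real \<Rightarrow> real \<Rightarrow> real \<Rightarrow> ('m::finite, 'k::finite) quadruple set \<Rightarrow> bool"
  where "oscillation_decay q \<theta> \<gamma> p M \<kappa> S \<longleftrightarrow>
    (\<forall>(u, \<Omega>, f, A)\<in>S. \<forall>G d.
       has_L2_gradient u G (ball 0 1) \<and> has_Lq_divergence q \<Omega> d (ball 0 1) \<and>
       Linf_norm (ball 0 1) u \<le> M \<longrightarrow>
       (let D_src = Lp_norm q (ball 0 1) f + M * Lp_norm q (ball 0 1) d;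
            D_frz = Linf_norm (ball 0 1) (\<lambda>x. A x - A 0) * Lp_norm 2 (ball 0 1) G
        in oscillation p u (ball 0 \<theta>)
             \<le> \<gamma> * oscillation p u (ball 0 1) + \<kappa> * (D_src powr p + D_frz powr p)))"

end

theory Submission
  imports Defs
begin

text \<open>Applying the decay hypothesis to the rescaled quadruples and iterating it gives
  \<open>oscillation p u (ball x r) < L * r powr (p * \<eta>)\<close> for all small \<open>r\<close>: the source and freezing terms
  scale with the powers \<open>2 - m/q\<close> and \<open>\<gamma>\<^sub>0 + (2 - m)/2\<close> of \<open>r\<close>, both larger than \<open>\<eta>\<close>, and
  \<open>\<gamma> < \<theta> powr (p * \<eta>)\<close>. By Campanato's argument the averages of \<open>u\<close> over the dyadic cubes with lower
  corner \<open>x\<close> then converge at a geometric rate, and their limit is Hoelder continuous. By Lebesgue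
  differentiation the limit equals \<open>u\<close> a.e.; it depends on neither the exponent nor the compact set.\<close>

section \<open>Affine changes of variables\<close>

text \<open>Oscillations are taken over balls, averages over cubes: the differentiation theorem used
  here concerns cubes \<open>cbox x (x + h *\<^sub>R One)\<close> that have the point itself as a
  corner. The constants therefore contain the ratio of the volumes of a ball and of a cube inside
  it. A cube of side \<open>h\<close> whose corner is within \<open>2 * h\<close> of
  \<open>x\<close> lies in the ball around \<open>x\<close> of radius
  \<open>(DIM('a) + 3) * h\<close>; this is where the number \<open>DIM('a) + 3\<close> comes from.
  Closure under rescaling holds only up to equality almost everywhere, and weak derivatives are
  relations. Each ingredient of the decay hypothesis thus has to be carried through the affine map
  and then to another representative. The oscillation bound is strict so that a constant
  \<open>c\<close> realising it exists without asking whether the infimum is attained. The price is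
  the summand \<open>1\<close> in \<open>oscillation_constant\<close>.\<close>

lemma affine_measurable_ball:
  fixes x0 :: "'a::euclidean_space"
  assumes "r > 0"
  shows "(\<lambda>y. x0 + r *\<^sub>R y) \<in> lebesgue_on (ball 0 s) \<rightarrow>\<^sub>M lebesgue_on (ball x0 (r * s))"
proof (rule measurable_restrict_space3)
  have "(\<lambda>x. x0 + (\<Sum>j\<in>Basis. (r * (x \<bullet> j)) *\<^sub>R j)) = (\<lambda>y. x0 + r *\<^sub>R y)"
    unfolding scaleR_scaleR[symmetric] scaleR_sum_right[symmetric] euclidean_representation ..
  then show "(\<lambda>y. x0 + r *\<^sub>R y) \<in> lebesgue \<rightarrow>\<^sub>M lebesgue"
    using lebesgue_affine_measurable[of "\<lambda>_. r" x0] assms by simp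
  show "(\<lambda>y. x0 + r *\<^sub>R y) \<in> ball 0 s \<rightarrow> ball x0 (r * s)"
    using assms by (auto simp: dist_norm)
qed

text \<open>The change of variables is proved once, as an identity of measures; integrals,
  integrability and statements almost everywhere all transfer along it. The radius \<open>s\<close>
  stays free because oscillations are rescaled both on the unit ball and on
  \<open>ball 0 \<theta>\<close>.\<close>

lemma distr_ball_affine:
  fixes x0 :: "'a::euclidean_space"
  assumes "r > 0"
  shows "distr (lebesgue_on (ball 0 s)) (lebesgue_on (ball x0 (r * s))) (\<lambda>y. x0 + r *\<^sub>R y)
    = density (lebesgue_on (ball x0 (r * s))) (\<lambda>_. ennreal ((1 / r) ^ DIM('a)))" (is "?L = ?R")
proof (rule measure_eqI)
  show "sets ?L = sets ?R" by simp
  fix A assume "A \<in> sets ?L"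
  then have A: "A \<in> sets (lebesgue_on (ball x0 (r * s)))" by simp
  then have Asub: "A \<subseteq> ball x0 (r * s)"
    by (auto simp: sets_restrict_space)
  let ?P = "(\<lambda>y. x0 + r *\<^sub>R y) -` A \<inter> ball 0 s"
  \<comment> \<open>The volume formula for affine maps concerns images, so the preimage is rewritten
    as the image under the inverse map.\<close>
  have eq: "?P = (\<lambda>x. (1 / r) *\<^sub>R x + (- (1 / r) *\<^sub>R x0)) ` A"
  proof (intro set_eqI iffI)
    fix y assume "y \<in> ?P"
    then show "y \<in> (\<lambda>x. (1 / r) *\<^sub>R x + (- (1 / r) *\<^sub>R x0)) ` A"
      using assms by (intro image_eqI[of _ _ "x0 + r *\<^sub>R y"]) (auto simp: scaleR_add_right)
  next
    fix y assume "y \<in> (\<lambda>x. (1 / r) *\<^sub>R x + (- (1 / r) *\<^sub>R x0)) ` A"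
    then obtain x where x: "x \<in> A" "y = (1 / r) *\<^sub>R (x - x0)"
      by (auto simp: scaleR_diff_right)
    then have "x0 + r *\<^sub>R y = x" using assms by simp
    moreover have "norm y < s"
    proof -
      have "norm (x - x0) < r * s"
        using x Asub by (auto simp: dist_norm norm_minus_commute)
      moreover have "norm y = norm (x - x0) / r" unfolding x(2) using assms by simp
      ultimately show ?thesis using assms by (simp add: pos_divide_less_eq mult.commute)
    qed
    ultimately show "y \<in> ?P" using x by auto
  qed
  have "emeasure ?L A = emeasure (lebesgue_on (ball 0 s)) ?P"
    using A by (subst emeasure_distr[OF affine_measurable_ball[OF assms]]) simp_all
  also have "\<dots> = emeasure lebesgue ?P"
    by (subst emeasure_restrict_space) auto
  also have "\<dots> = ennreal ((1 / r) ^ DIM('a)) * emeasure lebesgue A"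
    unfolding eq emeasure_lebesgue_affine using assms by (simp add: ennreal_power)
  also have "\<dots> = ennreal ((1 / r) ^ DIM('a)) * emeasure (lebesgue_on (ball x0 (r * s))) A"
    using Asub by (subst emeasure_restrict_space) auto
  also have "\<dots> = emeasure ?R A"
    using A by (subst emeasure_density_const) auto
  finally show "emeasure ?L A = emeasure ?R A" .
qed

lemma integral_ball_affine:
  fixes x0 :: "'a::euclidean_space" and g :: "'a \<Rightarrow> 'b::euclidean_space"
  assumes "r > 0" and "g \<in> borel_measurable (lebesgue_on (ball x0 (r * s)))"
  shows "(\<integral>y. g (x0 + r *\<^sub>R y) \<partial>lebesgue_on (ball 0 s))
    = (1 / r) ^ DIM('a) *\<^sub>R (\<integral>x. g x \<partial>lebesgue_on (ball x0 (r * s)))"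
proof -
  have "(\<integral>y. g (x0 + r *\<^sub>R y) \<partial>lebesgue_on (ball 0 s))
    = (\<integral>x. g x \<partial>density (lebesgue_on (ball x0 (r * s))) (\<lambda>_. ennreal ((1 / r) ^ DIM('a))))"
    unfolding distr_ball_affine[OF assms(1), symmetric]
    by (subst integral_distr[OF affine_measurable_ball[OF assms(1)] assms(2)]) simp
  also have "\<dots> = (1 / r) ^ DIM('a) *\<^sub>R (\<integral>x. g x \<partial>lebesgue_on (ball x0 (r * s)))"
    using assms by (subst integral_density) (auto intro!: AE_I2)
  finally show ?thesis .
qed

lemma integrable_ball_affine:
  fixes x0 :: "'a::euclidean_space" and g :: "'a \<Rightarrow> 'b::euclidean_space"
  assumes "r > 0" and "integrable (lebesgue_on (ball x0 (r * s))) g"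
  shows "integrable (lebesgue_on (ball 0 s)) (\<lambda>y. g (x0 + r *\<^sub>R y))"
proof -
  have "integrable (density (lebesgue_on (ball x0 (r * s))) (\<lambda>_. ennreal ((1 / r) ^ DIM('a)))) g"
    using assms by (subst integrable_density) (auto intro!: AE_I2)
  then show ?thesis
    unfolding distr_ball_affine[OF assms(1), symmetric]
    by (rule integrable_distr[OF affine_measurable_ball[OF assms(1)]])
qed

lemma AE_ball_affine:
  fixes x0 :: "'a::euclidean_space"
  assumes "r > 0" and "AE x in lebesgue_on (ball x0 (r * s)). P x"
  shows "AE y in lebesgue_on (ball 0 s). P (x0 + r *\<^sub>R y)"
proof -
  have "AE x in density (lebesgue_on (ball x0 (r * s))) (\<lambda>_. ennreal ((1 / r) ^ DIM('a))). P x"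
    using assms(2) by (subst AE_density) auto
  then show ?thesis
    unfolding distr_ball_affine[OF assms(1), symmetric]
    by (rule AE_distrD[OF affine_measurable_ball[OF assms(1)]])
qed

lemma measurable_ball_affine:
  fixes x0 :: "'a::euclidean_space" 
  assumes "r > 0" and "g \<in> borel_measurable (lebesgue_on (ball x0 (r * s)))"
  shows "(\<lambda>y. g (x0 + r *\<^sub>R y)) \<in> borel_measurable (lebesgue_on (ball 0 s))"
  using measurable_compose[OF affine_measurable_ball[OF assms(1)] assms(2)] .

section \<open>Derivatives and smoothness of rescaled functions\<close>

lemma has_derivative_scale:
  fixes \<phi> :: "real^'m \<Rightarrow> real"
  assumes "\<And>x. \<phi> differentiable (at x)"
  shows "((\<lambda>x. c * \<phi> (a *\<^sub>R (x - x0))) has_derivative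
      (\<lambda>h. c * frechet_derivative \<phi> (at (a *\<^sub>R (x - x0))) (a *\<^sub>R h))) (at x)"
proof -
  have "(\<phi> has_derivative frechet_derivative \<phi> (at (a *\<^sub>R (x - x0)))) (at (a *\<^sub>R (x - x0)))"
    using assms by (simp add: frechet_derivative_works[symmetric])
  then have "((\<lambda>x. \<phi> (a *\<^sub>R (x - x0))) has_derivative
    (\<lambda>h. frechet_derivative \<phi> (at (a *\<^sub>R (x - x0))) (a *\<^sub>R h))) (at x)"
    by (rule has_derivative_compose[of "\<lambda>x. a *\<^sub>R (x - x0)" "\<lambda>h. a *\<^sub>R h" x UNIV, rotated])
      (auto intro!: derivative_eq_intros)
  then show ?thesis by (intro has_derivative_mult_right)
qed

lemma partial_deriv_scale:
  fixes \<phi> :: "real^'m \<Rightarrow> real"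
  assumes "\<And>x. \<phi> differentiable (at x)"
  shows "partial_deriv i (\<lambda>x. c * \<phi> (a *\<^sub>R (x - x0))) x
      = (c * a) * partial_deriv i \<phi> (a *\<^sub>R (x - x0))"
proof -
  have lin: "linear (frechet_derivative \<phi> (at (a *\<^sub>R (x - x0))))"
    using assms by (simp add: linear_frechet_derivative)
  show ?thesis
    unfolding partial_deriv_def frechet_derivative_at[OF has_derivative_scale[OF assms], symmetric]
    by (simp add: linear_cmul[OF lin])
qed

text \<open>The free factor \<open>c\<close> makes the induction work: a partial derivative of such
  a function is again a constant times a rescaled function, with the factor
  \<open>c * a\<close>.\<close>

lemma C_k_scale:
  "C_k k \<phi> \<Longrightarrow> C_k k (\<lambda>x. c * \<phi> (a *\<^sub>R (x - x0)))"
proof (induction k arbitrary: \<phi> c)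
  case 0
  then show ?case
    by (auto intro!: continuous_intros continuous_on_compose2[of UNIV \<phi>])
next
  case (Suc k)
  then have diff: "\<And>x. \<phi> differentiable (at x)" by simp
  have "(\<lambda>x. c * \<phi> (a *\<^sub>R (x - x0))) differentiable (at x)" for x
    using has_derivative_scale[OF diff] by (rule differentiableI)
  moreover have "partial_deriv i (\<lambda>x. c * \<phi> (a *\<^sub>R (x - x0)))
      = (\<lambda>x. (c * a) * partial_deriv i \<phi> (a *\<^sub>R (x - x0)))" for i
    by (rule ext) (rule partial_deriv_scale[OF diff])
  ultimately show ?case using Suc by simp
qed

section \<open>Rescaling weak derivatives\<close>

lemma test_functions_mono: "U \<subseteq> V \<Longrightarrow> test_functions U \<subseteq> test_functions V"
  by (auto simp: test_functions_def)

lemma test_functions_differentiable: "\<phi> \<in> test_functions U \<Longrightarrow> \<phi> differentiable (at x)"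
proof -
  assume "\<phi> \<in> test_functions U"
  then have "C_k (Suc 0) \<phi>" unfolding test_functions_def by blast
  then show ?thesis by simp
qed

lemma test_functions_measurable:
  assumes "\<phi> \<in> test_functions U"
  shows "\<phi> \<in> borel_measurable (lebesgue_on S)"
    and "partial_deriv i \<phi> \<in> borel_measurable (lebesgue_on S)"
proof -
  have "C_k 0 \<phi>" "C_k (Suc 0) \<phi>" using assms unfolding test_functions_def by blast+
  then have "continuous_on UNIV \<phi>" "continuous_on UNIV (partial_deriv i \<phi>)" by auto
  then have "\<phi> \<in> borel_measurable borel" "partial_deriv i \<phi> \<in> borel_measurable borel"
    by (auto intro: borel_measurable_continuous_onI)
  then show "\<phi> \<in> borel_measurable (lebesgue_on S)"
    "partial_deriv i \<phi> \<in> borel_measurable (lebesgue_on S)"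
    by (auto intro!: measurable_restrict_space1 measurable_completion)
qed

text \<open>Outside the closed support there is a whole neighbourhood on which \<open>\<phi>\<close>
  vanishes, so its derivatives vanish there too. This allows integrals against test functions to be
  moved between the small ball and the unit ball.\<close>

lemma test_functions_zero:
  assumes "\<phi> \<in> test_functions U" "x \<notin> U"
  shows "\<phi> x = 0" and "partial_deriv i \<phi> x = 0"
proof -
  let ?S = "closure {x. \<phi> x \<noteq> 0}"
  have x: "x \<in> - ?S" using assms by (auto simp: test_functions_def)
  have 0: "\<phi> y = 0" if "y \<in> - ?S" for y
    using that closure_subset[of "{x. \<phi> x \<noteq> 0}"] by auto
  show "\<phi> x = 0" using 0 x by blast
  have "(\<phi> has_derivative (\<lambda>_. 0)) (at x)"
  proof (rule has_derivative_transform_within_open)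
    show "((\<lambda>_. 0) has_derivative (\<lambda>_. 0)) (at x)" by (rule has_derivative_const)
    show "open (- ?S)" by (intro open_Compl closed_closure)
    show "x \<in> - ?S" by (rule x)
    show "0 = \<phi> y" if "y \<in> - ?S" for y by (rule 0[OF that, symmetric])
  qed
  then show "partial_deriv i \<phi> x = 0"
    unfolding partial_deriv_def by (simp add: frechet_derivative_at[symmetric])
qed

text \<open>Turns a test function for the rescaled quadruple into one for the original. The affine
  image of the support is compact, hence closed, so it contains the closure of the set where the new
  function is nonzero.\<close>

lemma test_functions_scale:
  assumes "\<phi> \<in> test_functions (ball 0 1)" "r > 0"
  shows "(\<lambda>x. \<phi> ((1 / r) *\<^sub>R (x - x0))) \<in> test_functions (ball x0 r)"
proof -
  let ?f = "\<lambda>x. \<phi> ((1 / r) *\<^sub>R (x - x0))"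
  let ?T = "\<lambda>y. x0 + r *\<^sub>R y"
  let ?K = "closure {x. \<phi> x \<noteq> 0}"
  have K: "compact ?K" "?K \<subseteq> ball 0 1" using assms by (auto simp: test_functions_def)
  have TK: "compact (?T ` ?K)"
    using K(1) by (intro compact_continuous_image) (auto intro!: continuous_intros)
  have "{x. ?f x \<noteq> 0} \<subseteq> ?T ` ?K"
  proof
    fix x assume "x \<in> {x. ?f x \<noteq> 0}"
    then have "(1 / r) *\<^sub>R (x - x0) \<in> ?K" using closure_subset by fast
    moreover have "x = ?T ((1 / r) *\<^sub>R (x - x0))" using assms by simp
    ultimately show "x \<in> ?T ` ?K" by blast
  qed
  then have sub: "closure {x. ?f x \<noteq> 0} \<subseteq> ?T ` ?K"
    using TK by (intro closure_minimal compact_imp_closed)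
  have "?T ` ?K \<subseteq> ball x0 r"
    using K(2) assms(2) by (auto simp: dist_norm)
  moreover have "compact (closure {x. ?f x \<noteq> 0})"
    using compact_Int_closed[OF TK, of "closure {x. ?f x \<noteq> 0}"] sub by (simp add: Int_absorb1)
  moreover have "C_k k ?f" for k
    using C_k_scale[of k \<phi> 1] assms(1) by (simp add: test_functions_def)
  ultimately show ?thesis using sub by (auto simp: test_functions_def)
qed

section \<open>Integrals over subsets and Lebesgue norms of rescaled functions\<close>

lemma integral_lebesgue_on_support:
  fixes h :: "'a::euclidean_space \<Rightarrow> 'b::euclidean_space"
  assumes "S \<subseteq> T" "S \<in> sets lebesgue" "T \<in> sets lebesgue" "\<And>x. x \<in> T - S \<Longrightarrow> h x = 0"
  shows "(\<integral>x. h x \<partial>lebesgue_on T) = (\<integral>x. h x \<partial>lebesgue_on S)"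
proof -
  have "(\<integral>x. h x \<partial>lebesgue_on T) = (\<integral>x. indicator T x *\<^sub>R h x \<partial>lebesgue)"
    using assms by (subst integral_restrict_space) auto
  also have "\<dots> = (\<integral>x. indicator S x *\<^sub>R h x \<partial>lebesgue)"
    using assms by (intro Bochner_Integration.integral_cong) (auto simp: indicator_def)
  also have "\<dots> = (\<integral>x. h x \<partial>lebesgue_on S)"
    using assms by (subst integral_restrict_space) auto
  finally show ?thesis .
qed

lemma integrable_lebesgue_on_subset:
  fixes h :: "'a::euclidean_space \<Rightarrow> 'b::euclidean_space"
  assumes "integrable (lebesgue_on T) h" "S \<subseteq> T" "S \<in> sets lebesgue" "T \<in> sets lebesgue"
  shows "integrable (lebesgue_on S) h"
  using assms set_integrable_subset[of lebesgue T h S]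
  by (simp add: integrable_restrict_space set_integrable_def)

lemma integral_lebesgue_on_mono_set:
  fixes h :: "'a::euclidean_space \<Rightarrow> real"
  assumes "integrable (lebesgue_on T) h" "S \<subseteq> T" "S \<in> sets lebesgue" "T \<in> sets lebesgue"
    and "\<And>x. h x \<ge> 0"
  shows "(\<integral>x. h x \<partial>lebesgue_on S) \<le> (\<integral>x. h x \<partial>lebesgue_on T)"
proof -
  have "(\<integral>x. indicator S x *\<^sub>R h x \<partial>lebesgue) \<le> (\<integral>x. indicator T x *\<^sub>R h x \<partial>lebesgue)"
    using assms integrable_lebesgue_on_subset[OF assms(1-4)]
    by (intro integral_mono) (auto simp: integrable_restrict_space indicator_def)
  then show ?thesis using assms by (simp add: integral_restrict_space)
qed

lemma borel_measurable_vec_nth: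
  fixes f :: "'a \<Rightarrow> 'b::euclidean_space ^ 'n"
  assumes "f \<in> borel_measurable M"
  shows "(\<lambda>x. f x $ i) \<in> borel_measurable M"
  by (rule measurable_compose[OF assms], rule borel_measurable_continuous_onI)
    (intro continuous_intros)

text \<open>The power of \<open>r\<close> is the \<open>p\<close>-th root of the Jacobian. The norm
  estimate is an inequality because the integral over the small ball is enlarged to the unit ball,
  so that the final constant involves only norms on the latter.\<close>

lemma Lp_space_scale:
  fixes f :: "'a::euclidean_space \<Rightarrow> 'b::euclidean_space"
  assumes f: "f \<in> Lp_space p (ball 0 1)" and r: "r > 0" "ball x0 r \<subseteq> ball 0 1" and p: "p > 0"
  shows "(\<lambda>y. c *\<^sub>R f (x0 + r *\<^sub>R y)) \<in> Lp_space p (ball 0 1)"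
    and "Lp_norm p (ball 0 1) (\<lambda>y. c *\<^sub>R f (x0 + r *\<^sub>R y))
      \<le> \<bar>c\<bar> * r powr (- real DIM('a) / p) * Lp_norm p (ball 0 1) f"
proof -
  let ?B = "ball 0 1 :: 'a set"
  have fm: "f \<in> borel_measurable (lebesgue_on ?B)"
    and fi: "integrable (lebesgue_on ?B) (\<lambda>x. norm (f x) powr p)"
    using f by (auto simp: Lp_space_def)
  have fm': "f \<in> borel_measurable (lebesgue_on (ball x0 (r * 1)))"
    using measurable_restrict_mono[OF fm r(2)] by simp
  have fi': "integrable (lebesgue_on (ball x0 (r * 1))) (\<lambda>x. norm (f x) powr p)"
    using integrable_lebesgue_on_subset[OF fi r(2)] by simp
  have m: "(\<lambda>y. f (x0 + r *\<^sub>R y)) \<in> borel_measurable (lebesgue_on ?B)"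
    by (rule measurable_ball_affine[OF r(1) fm'])
  have i: "integrable (lebesgue_on ?B) (\<lambda>y. norm (f (x0 + r *\<^sub>R y)) powr p)"
    by (rule integrable_ball_affine[OF r(1) fi'])
  have eq: "norm (c *\<^sub>R f (x0 + r *\<^sub>R y)) powr p = \<bar>c\<bar> powr p * norm (f (x0 + r *\<^sub>R y)) powr p" for y
    by (simp add: powr_mult)
  show "(\<lambda>y. c *\<^sub>R f (x0 + r *\<^sub>R y)) \<in> Lp_space p ?B"
    unfolding Lp_space_def using m i
    by (intro CollectI conjI) (simp_all add: eq del: norm_scaleR)
  let ?I = "\<integral>x. norm (f x) powr p \<partial>lebesgue_on ?B"
  have "(\<integral>y. norm (c *\<^sub>R f (x0 + r *\<^sub>R y)) powr p \<partial>lebesgue_on ?B)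
      = \<bar>c\<bar> powr p * (\<integral>y. norm (f (x0 + r *\<^sub>R y)) powr p \<partial>lebesgue_on ?B)"
    by (simp add: eq del: norm_scaleR)
  also have "\<dots> = \<bar>c\<bar> powr p * ((1 / r) ^ DIM('a) * (\<integral>x. norm (f x) powr p \<partial>lebesgue_on (ball x0 r)))"
    using integral_ball_affine[OF r(1), of "\<lambda>x. norm (f x) powr p" x0 1] fm' by simp
  also have "\<dots> \<le> \<bar>c\<bar> powr p * ((1 / r) ^ DIM('a) * ?I)"
    using r by (intro mult_left_mono integral_lebesgue_on_mono_set[OF fi]) auto
  also have "\<dots> = (\<bar>c\<bar> powr p * r powr (- real DIM('a))) * ?I"
    using powr_realpow[OF r(1), of "DIM('a)"] by (simp add: powr_minus_divide power_one_over)
  finally have le: "(\<integral>y. norm (c *\<^sub>R f (x0 + r *\<^sub>R y)) powr p \<partial>lebesgue_on ?B)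
    \<le> (\<bar>c\<bar> powr p * r powr (- real DIM('a))) * ?I" .
  have "Lp_norm p ?B (\<lambda>y. c *\<^sub>R f (x0 + r *\<^sub>R y))
      \<le> ((\<bar>c\<bar> powr p * r powr (- real DIM('a))) * ?I) powr (1 / p)"
    unfolding Lp_norm_def using le p
    by (intro powr_mono2) (auto intro: Bochner_Integration.integral_nonneg)
  also have "\<dots> = \<bar>c\<bar> * r powr (- real DIM('a) / p) * Lp_norm p ?B f"
    unfolding Lp_norm_def using p by (simp add: powr_mult powr_powr)
  finally show "Lp_norm p ?B (\<lambda>y. c *\<^sub>R f (x0 + r *\<^sub>R y))
      \<le> \<bar>c\<bar> * r powr (- real DIM('a) / p) * Lp_norm p ?B f" .
qed

text \<open>The weak identities are given on the unit ball, not on \<open>ball x0 r\<close>. For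
  integrands supported in the small ball the change of variables can have the unit ball on both
  sides.\<close>

lemma integral_ball_affine_support:
  fixes x0 :: "'a::euclidean_space" and h :: "'a \<Rightarrow> real"
  assumes r: "r > 0" "ball x0 r \<subseteq> ball 0 1"
    and h: "h \<in> borel_measurable (lebesgue_on (ball x0 r))" "\<And>x. x \<notin> ball x0 r \<Longrightarrow> h x = 0"
  shows "(\<integral>y. h (x0 + r *\<^sub>R y) \<partial>lebesgue_on (ball 0 1))
    = (1 / r) ^ DIM('a) * (\<integral>x. h x \<partial>lebesgue_on (ball 0 1))"
proof -
  have "(\<integral>x. h x \<partial>lebesgue_on (ball 0 1)) = (\<integral>x. h x \<partial>lebesgue_on (ball x0 (r * 1)))"
    using h(2) by (subst integral_lebesgue_on_support[OF r(2)]) auto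
  then show ?thesis
    using integral_ball_affine[OF r(1), of h x0 1] h(1) by simp
qed

text \<open>Testing the rescaled function with \<open>\<phi>\<close> amounts to testing
  \<open>u\<close> with \<open>\<phi>\<close> composed with the inverse affine map. The Jacobian
  appears on both sides of the weak identity and cancels; the chain rule leaves one factor
  \<open>r\<close>.\<close>

lemma has_L2_gradient_scale:
  fixes u :: "real^'m \<Rightarrow> real^'k"
  assumes G: "has_L2_gradient u G (ball 0 1)" and r: "r > 0" "ball x0 r \<subseteq> ball 0 1"
    and um: "u \<in> borel_measurable (lebesgue_on (ball 0 1))"
  shows "has_L2_gradient (\<lambda>y. u (x0 + r *\<^sub>R y)) (\<lambda>y. r *\<^sub>R G (x0 + r *\<^sub>R y)) (ball 0 1)"
  unfolding has_L2_gradient_def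
proof (intro conjI ballI allI)
  have GL: "G \<in> Lp_space 2 (ball 0 1)" using G by (simp add: has_L2_gradient_def)
  show "(\<lambda>y. r *\<^sub>R G (x0 + r *\<^sub>R y)) \<in> Lp_space 2 (ball 0 1)"
    by (rule Lp_space_scale(1)[OF GL r]) simp
  fix \<phi> :: "real^'m \<Rightarrow> real" and a i assume phi: "\<phi> \<in> test_functions (ball 0 1)"
  define \<psi> where "\<psi> = (\<lambda>x. \<phi> ((1 / r) *\<^sub>R (x - x0)))"
  have psi: "\<psi> \<in> test_functions (ball x0 r)"
    unfolding \<psi>_def by (rule test_functions_scale[OF phi r(1)])
  have psi1: "\<psi> \<in> test_functions (ball 0 1)" using test_functions_mono[OF r(2)] psi by blast
  have inv: "(1 / r) *\<^sub>R (x0 + r *\<^sub>R y - x0) = y" for y using r(1) by simp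
  have dpsi: "partial_deriv i \<phi> y = r * partial_deriv i \<psi> (x0 + r *\<^sub>R y)" for y
  proof -
    have "partial_deriv i \<psi> x = (1 / r) * partial_deriv i \<phi> ((1 / r) *\<^sub>R (x - x0))" for x
      using partial_deriv_scale[OF test_functions_differentiable[OF phi], of i 1 "1 / r" x0 x]
      unfolding \<psi>_def by (simp only: mult_1_left)
    then show ?thesis using r(1) by (simp add: inv)
  qed
  have ppsi: "\<phi> y = \<psi> (x0 + r *\<^sub>R y)" for y by (simp only: \<psi>_def inv)
  have um': "u \<in> borel_measurable (lebesgue_on (ball x0 r))"
    by (rule measurable_restrict_mono[OF um r(2)])
  have Gm': "G \<in> borel_measurable (lebesgue_on (ball x0 r))"
    by (rule measurable_restrict_mono[OF _ r(2)]) (use GL in \<open>simp add: Lp_space_def\<close>)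
  have m1: "(\<lambda>x. u x $ a * partial_deriv i \<psi> x) \<in> borel_measurable (lebesgue_on (ball x0 r))"
    by (intro borel_measurable_times borel_measurable_vec_nth um' test_functions_measurable[OF psi])
  have z1: "u x $ a * partial_deriv i \<psi> x = 0" if "x \<notin> ball x0 r" for x
    by (simp only: test_functions_zero(2)[OF psi that] mult_zero_right)
  have m2: "(\<lambda>x. G x $ a $ i * \<psi> x) \<in> borel_measurable (lebesgue_on (ball x0 r))"
    by (intro borel_measurable_times borel_measurable_vec_nth Gm' test_functions_measurable[OF psi])
  have z2: "G x $ a $ i * \<psi> x = 0" if "x \<notin> ball x0 r" for x
    by (simp only: test_functions_zero(1)[OF psi that] mult_zero_right)
  have 1: "(\<integral>y. u (x0 + r *\<^sub>R y) $ a * partial_deriv i \<psi> (x0 + r *\<^sub>R y) \<partial>lebesgue_on (ball 0 1))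
      = (1 / r) ^ DIM(real^'m) * (\<integral>x. u x $ a * partial_deriv i \<psi> x \<partial>lebesgue_on (ball 0 1))"
    by (rule integral_ball_affine_support[OF r m1 z1])
  have 2: "(\<integral>y. G (x0 + r *\<^sub>R y) $ a $ i * \<psi> (x0 + r *\<^sub>R y) \<partial>lebesgue_on (ball 0 1))
      = (1 / r) ^ DIM(real^'m) * (\<integral>x. G x $ a $ i * \<psi> x \<partial>lebesgue_on (ball 0 1))"
    by (rule integral_ball_affine_support[OF r m2 z2])
  have weak: "(\<integral>x. u x $ a * partial_deriv i \<psi> x \<partial>lebesgue_on (ball 0 1))
      = - (\<integral>x. G x $ a $ i * \<psi> x \<partial>lebesgue_on (ball 0 1))"
    using G psi1 unfolding has_L2_gradient_def by blast
  have "(\<integral>y. u (x0 + r *\<^sub>R y) $ a * partial_deriv i \<phi> y \<partial>lebesgue_on (ball 0 1))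
      = r * (\<integral>y. u (x0 + r *\<^sub>R y) $ a * partial_deriv i \<psi> (x0 + r *\<^sub>R y) \<partial>lebesgue_on (ball 0 1))"
    by (subst integral_mult_right_zero[symmetric]) (simp only: dpsi mult.left_commute)
  also have "\<dots> = - (r * (\<integral>y. G (x0 + r *\<^sub>R y) $ a $ i * \<psi> (x0 + r *\<^sub>R y) \<partial>lebesgue_on (ball 0 1)))"
    by (simp only: 1 2 weak mult_minus_right)
  also have "r * (\<integral>y. G (x0 + r *\<^sub>R y) $ a $ i * \<psi> (x0 + r *\<^sub>R y) \<partial>lebesgue_on (ball 0 1))
      = (\<integral>y. (r *\<^sub>R G (x0 + r *\<^sub>R y)) $ a $ i * \<phi> y \<partial>lebesgue_on (ball 0 1))"
    by (subst integral_mult_right_zero[symmetric]) (simp only: ppsi vector_scaleR_component real_scaleR_def mult.assoc)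
  finally show "(\<integral>y. u (x0 + r *\<^sub>R y) $ a * partial_deriv i \<phi> y \<partial>lebesgue_on (ball 0 1))
    = - (\<integral>y. (r *\<^sub>R G (x0 + r *\<^sub>R y)) $ a $ i * \<phi> y \<partial>lebesgue_on (ball 0 1))" .
qed

text \<open>One factor of \<open>r\<^sup>2\<close> is built into the rescaled field, the other comes
  from differentiating the test function.\<close>

lemma has_Lq_divergence_scale:
  fixes \<Omega> :: "real^'m \<Rightarrow> (real^'m)^'k^'k"
  assumes d: "has_Lq_divergence q \<Omega> d (ball 0 1)" and r: "r > 0" "ball x0 r \<subseteq> ball 0 1"
    and q: "q > 0" and Om: "\<Omega> \<in> borel_measurable (lebesgue_on (ball 0 1))"
  shows "has_Lq_divergence q (\<lambda>y. r *\<^sub>R \<Omega> (x0 + r *\<^sub>R y)) (\<lambda>y. r\<^sup>2 *\<^sub>R d (x0 + r *\<^sub>R y)) (ball 0 1)"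
  unfolding has_Lq_divergence_def
proof (intro conjI ballI allI)
  have dL: "d \<in> Lp_space q (ball 0 1)" using d by (simp add: has_Lq_divergence_def)
  show "(\<lambda>y. r\<^sup>2 *\<^sub>R d (x0 + r *\<^sub>R y)) \<in> Lp_space q (ball 0 1)"
    by (rule Lp_space_scale(1)[OF dL r q])
  fix \<phi> :: "real^'m \<Rightarrow> real" and a b assume phi: "\<phi> \<in> test_functions (ball 0 1)"
  define \<psi> where "\<psi> = (\<lambda>x. \<phi> ((1 / r) *\<^sub>R (x - x0)))"
  have psi: "\<psi> \<in> test_functions (ball x0 r)"
    unfolding \<psi>_def by (rule test_functions_scale[OF phi r(1)])
  have psi1: "\<psi> \<in> test_functions (ball 0 1)" using test_functions_mono[OF r(2)] psi by blast
  let ?D = "\<lambda>x. \<chi> i. partial_deriv i \<psi> x"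
  have inv: "(1 / r) *\<^sub>R (x0 + r *\<^sub>R y - x0) = y" for y using r(1) by simp
  have dpsi: "(\<chi> i. partial_deriv i \<phi> y) = r *\<^sub>R ?D (x0 + r *\<^sub>R y)" for y
  proof -
    have "partial_deriv i \<psi> x = (1 / r) * partial_deriv i \<phi> ((1 / r) *\<^sub>R (x - x0))" for i x
      using partial_deriv_scale[OF test_functions_differentiable[OF phi], of i 1 "1 / r" x0 x]
      unfolding \<psi>_def by (simp only: mult_1_left)
    then show ?thesis using r(1) by (simp add: inv vec_eq_iff)
  qed
  have Dm: "(\<lambda>x. (\<Omega> x $ a $ b) \<bullet> ?D x) \<in> borel_measurable (lebesgue_on (ball x0 r))"
    unfolding inner_vec_def inner_real_def vec_lambda_beta
    by (intro borel_measurable_sum borel_measurable_times borel_measurable_vec_nth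
        measurable_restrict_mono[OF Om r(2)] test_functions_measurable(2)[OF psi])
  have ppsi: "\<phi> y = \<psi> (x0 + r *\<^sub>R y)" for y by (simp only: \<psi>_def inv)
  have dm': "d \<in> borel_measurable (lebesgue_on (ball x0 r))"
    by (rule measurable_restrict_mono[OF _ r(2)]) (use dL in \<open>simp add: Lp_space_def\<close>)
  have z1: "(\<Omega> x $ a $ b) \<bullet> ?D x = 0" if "x \<notin> ball x0 r" for x
    by (simp add: inner_vec_def test_functions_zero(2)[OF psi that])
  have m2: "(\<lambda>x. d x $ a $ b * \<psi> x) \<in> borel_measurable (lebesgue_on (ball x0 r))"
    by (intro borel_measurable_times borel_measurable_vec_nth dm' test_functions_measurable[OF psi])
  have z2: "d x $ a $ b * \<psi> x = 0" if "x \<notin> ball x0 r" for x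
    by (simp only: test_functions_zero(1)[OF psi that] mult_zero_right)
  have 1: "(\<integral>y. (\<Omega> (x0 + r *\<^sub>R y) $ a $ b) \<bullet> ?D (x0 + r *\<^sub>R y) \<partial>lebesgue_on (ball 0 1))
      = (1 / r) ^ DIM(real^'m) * (\<integral>x. (\<Omega> x $ a $ b) \<bullet> ?D x \<partial>lebesgue_on (ball 0 1))"
    by (rule integral_ball_affine_support[OF r Dm z1])
  have 2: "(\<integral>y. d (x0 + r *\<^sub>R y) $ a $ b * \<psi> (x0 + r *\<^sub>R y) \<partial>lebesgue_on (ball 0 1))
      = (1 / r) ^ DIM(real^'m) * (\<integral>x. d x $ a $ b * \<psi> x \<partial>lebesgue_on (ball 0 1))"
    by (rule integral_ball_affine_support[OF r m2 z2])
  have weak: "(\<integral>x. (\<Omega> x $ a $ b) \<bullet> ?D x \<partial>lebesgue_on (ball 0 1))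
      = - (\<integral>x. d x $ a $ b * \<psi> x \<partial>lebesgue_on (ball 0 1))"
    using d psi1 unfolding has_Lq_divergence_def by blast
  have "(\<integral>y. ((r *\<^sub>R \<Omega> (x0 + r *\<^sub>R y)) $ a $ b) \<bullet> (\<chi> i. partial_deriv i \<phi> y) \<partial>lebesgue_on (ball 0 1))
      = r\<^sup>2 * (\<integral>y. (\<Omega> (x0 + r *\<^sub>R y) $ a $ b) \<bullet> ?D (x0 + r *\<^sub>R y) \<partial>lebesgue_on (ball 0 1))"
    by (subst integral_mult_right_zero[symmetric])
      (simp only: dpsi vector_scaleR_component inner_scaleR_left inner_scaleR_right power2_eq_square mult.assoc)
  also have "\<dots> = - (r\<^sup>2 * (\<integral>y. d (x0 + r *\<^sub>R y) $ a $ b * \<psi> (x0 + r *\<^sub>R y) \<partial>lebesgue_on (ball 0 1)))"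
    by (simp only: 1 2 weak mult_minus_right)
  also have "r\<^sup>2 * (\<integral>y. d (x0 + r *\<^sub>R y) $ a $ b * \<psi> (x0 + r *\<^sub>R y) \<partial>lebesgue_on (ball 0 1))
      = (\<integral>y. (r\<^sup>2 *\<^sub>R d (x0 + r *\<^sub>R y)) $ a $ b * \<phi> y \<partial>lebesgue_on (ball 0 1))"
    by (subst integral_mult_right_zero[symmetric]) (simp only: ppsi vector_scaleR_component real_scaleR_def mult.assoc)
  finally show "(\<integral>y. ((r *\<^sub>R \<Omega> (x0 + r *\<^sub>R y)) $ a $ b) \<bullet> (\<chi> i. partial_deriv i \<phi> y) \<partial>lebesgue_on (ball 0 1))
    = - (\<integral>y. (r\<^sup>2 *\<^sub>R d (x0 + r *\<^sub>R y)) $ a $ b * \<phi> y \<partial>lebesgue_on (ball 0 1))" .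
qed

text \<open>Needed because closure under rescaling supplies only a quadruple that agrees almost
  everywhere with the rescaled one; its weak derivatives must be inherited.\<close>

lemma has_L2_gradient_cong_AE:
  assumes "has_L2_gradient u G U" "AE x in lebesgue_on U. u x = u' x"
    and "u \<in> borel_measurable (lebesgue_on U)" "u' \<in> borel_measurable (lebesgue_on U)"
  shows "has_L2_gradient u' G U"
  unfolding has_L2_gradient_def
proof (intro conjI ballI allI)
  show "G \<in> Lp_space 2 U" using assms(1) by (simp add: has_L2_gradient_def)
  fix \<phi> a i assume phi: "\<phi> \<in> test_functions U"
  have "(\<integral>x. u' x $ a * partial_deriv i \<phi> x \<partial>lebesgue_on U)
      = (\<integral>x. u x $ a * partial_deriv i \<phi> x \<partial>lebesgue_on U)"
    using assms(2)
    by (intro integral_cong_AE borel_measurable_times borel_measurable_vec_nth assms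
        test_functions_measurable[OF phi]) auto
  then show "(\<integral>x. u' x $ a * partial_deriv i \<phi> x \<partial>lebesgue_on U) = - (\<integral>x. G x $ a $ i * \<phi> x \<partial>lebesgue_on U)"
    using assms(1) phi by (simp add: has_L2_gradient_def)
qed

lemma has_Lq_divergence_cong_AE:
  assumes "has_Lq_divergence q \<Omega> d U" "AE x in lebesgue_on U. \<Omega> x = \<Omega>' x"
    and "\<Omega> \<in> borel_measurable (lebesgue_on U)" "\<Omega>' \<in> borel_measurable (lebesgue_on U)"
  shows "has_Lq_divergence q \<Omega>' d U"
  unfolding has_Lq_divergence_def
proof (intro conjI ballI allI)
  show "d \<in> Lp_space q U" using assms(1) by (simp add: has_Lq_divergence_def)
  fix \<phi> a b assume phi: "\<phi> \<in> test_functions U"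
  have "(\<integral>x. (\<Omega>' x $ a $ b) \<bullet> (\<chi> i. partial_deriv i \<phi> x) \<partial>lebesgue_on U)
      = (\<integral>x. (\<Omega> x $ a $ b) \<bullet> (\<chi> i. partial_deriv i \<phi> x) \<partial>lebesgue_on U)"
    using assms(2) test_functions_measurable[OF phi] unfolding inner_vec_def
    by (intro integral_cong_AE)
      (auto intro!: borel_measurable_sum borel_measurable_times borel_measurable_vec_nth assms)
  then show "(\<integral>x. (\<Omega>' x $ a $ b) \<bullet> (\<chi> i. partial_deriv i \<phi> x) \<partial>lebesgue_on U)
      = - (\<integral>x. d x $ a $ b * \<phi> x \<partial>lebesgue_on U)"
    using assms(1) phi by (simp add: has_Lq_divergence_def)
qed

section \<open>Averages over cubes\<close>

definition set_avg :: "('a::euclidean_space \<Rightarrow> 'b::euclidean_space) \<Rightarrow> 'a set \<Rightarrow> 'b"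
  where "set_avg u E = (1 / measure lebesgue E) *\<^sub>R (\<integral>y. u y \<partial>lebesgue_on E)"

definition cube :: "'a::euclidean_space \<Rightarrow> real \<Rightarrow> 'a set"
  where "cube x h = cbox x (x + h *\<^sub>R One)"

text \<open>The continuous representative of the theorem. The first cubes may leave the unit ball,
  where the values of \<open>u\<close> carry no meaning; only the tail of the sequence matters for
  the limit.\<close>

definition cube_limit :: "('a::euclidean_space \<Rightarrow> 'b::euclidean_space) \<Rightarrow> 'a \<Rightarrow> 'b"
  where "cube_limit u x = lim (\<lambda>k. set_avg u (cube x ((1 / 2) ^ k)))"

lemma measure_cube: "h \<ge> 0 \<Longrightarrow> measure lebesgue (cube (x::'a::euclidean_space) h) = h ^ DIM('a)"
  unfolding cube_def
  by (subst measure_completion) (auto simp: content_cbox_cases inner_add_left)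

lemma cube_measurable [simp]: "cube x h \<in> lmeasurable" "cube x h \<in> sets lebesgue"
  by (auto simp: cube_def)

text \<open>The Euclidean norm is at most the sum of the absolute values of the coordinates, each at
  most \<open>h\<close> on the cube; hence the factor \<open>DIM('a)\<close>.\<close>

lemma cube_subset_ball:
  fixes x :: "'a::euclidean_space"
  assumes "h > 0" "dist x z + real DIM('a) * h < r"
  shows "cube z h \<subseteq> ball x r"
proof
  fix y assume y: "y \<in> cube z h"
  have "norm (y - z) \<le> (\<Sum>b\<in>Basis. \<bar>(y - z) \<bullet> b\<bar>)" by (rule norm_le_l1)
  also have "\<dots> \<le> (\<Sum>b\<in>(Basis::'a set). h)"
    using y assms by (intro sum_mono)
      (auto simp: cube_def mem_box inner_add_left inner_diff_left abs_le_iff)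
  finally have "dist z y \<le> real DIM('a) * h" by (simp add: dist_norm norm_minus_commute)
  then show "y \<in> ball x r" using assms dist_triangle[of x y z] by simp
qed

lemma AE_lebesgue_on_subset:
  assumes "AE x in lebesgue_on T. P x" "S \<subseteq> T" "S \<in> sets lebesgue" "T \<in> sets lebesgue"
  shows "AE x in lebesgue_on S. P x"
  using assms by (auto simp: AE_restrict_space_iff elim!: eventually_mono)

lemma integrable_bounded_lebesgue_on:
  fixes u :: "'a::euclidean_space \<Rightarrow> 'b::euclidean_space"
  assumes "B \<in> lmeasurable" "u \<in> borel_measurable (lebesgue_on B)"
    and "AE x in lebesgue_on B. norm (u x) \<le> M"
  shows "integrable (lebesgue_on B) u"
  using finite_measure.integrable_const_bound[OF finite_measure_lebesgue_on[OF assms(1)] assms(3,2)] .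

lemma integrable_bounded_powr:
  fixes u :: "'a::euclidean_space \<Rightarrow> 'b::euclidean_space"
  assumes B: "B \<in> lmeasurable" "u \<in> borel_measurable (lebesgue_on B)"
    and M: "AE x in lebesgue_on B. norm (u x) \<le> M" and p: "p \<ge> 0"
  shows "integrable (lebesgue_on B) (\<lambda>x. norm (u x - c) powr p)"
proof (rule integrable_bounded_lebesgue_on[OF B(1)])
  show "(\<lambda>x. norm (u x - c) powr p) \<in> borel_measurable (lebesgue_on B)"
    using B by measurable
  show "AE x in lebesgue_on B. norm (norm (u x - c) powr p) \<le> (M + norm c) powr p"
    using M
  proof eventually_elim
    case (elim x)
    have "norm (u x - c) \<le> M + norm c" using elim norm_triangle_ineq4[of "u x" c] by linarith
    then show ?case using p by (simp add: powr_mono2)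
  qed
qed

lemma norm_set_avg_le:
  fixes u :: "'a::euclidean_space \<Rightarrow> 'b::euclidean_space"
  assumes E: "E \<in> lmeasurable" "measure lebesgue E > 0"
    and um: "u \<in> borel_measurable (lebesgue_on E)" and M: "AE x in lebesgue_on E. norm (u x) \<le> M"
  shows "norm (set_avg u E) \<le> M"
proof -
  interpret finite_measure "lebesgue_on E" by (rule finite_measure_lebesgue_on[OF E(1)])
  have i: "integrable (lebesgue_on E) u" by (rule integrable_bounded_lebesgue_on[OF E(1) um M])
  have "norm (\<integral>y. u y \<partial>lebesgue_on E) \<le> (\<integral>y. norm (u y) \<partial>lebesgue_on E)"
    by (rule integral_norm_bound)
  also have "\<dots> \<le> (\<integral>y. M \<partial>lebesgue_on E)"
    using i M by (intro integral_mono_AE) auto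
  also have "\<dots> = measure lebesgue E * M"
    using E by (simp add: measure_restrict_space fmeasurable_def)
  finally show ?thesis using E(2) by (simp add: set_avg_def field_simps)
qed

text \<open>The pointwise bound \<open>a \<le> s + s powr (1 - p) * a powr p\<close> replaces Jensen's inequality here.\<close>

lemma norm_set_avg_diff_le:
  fixes u :: "'a::euclidean_space \<Rightarrow> 'b::euclidean_space"
  assumes B: "B \<in> lmeasurable" and E: "E \<in> sets lebesgue" "E \<subseteq> B" "measure lebesgue E > 0"
    and um: "u \<in> borel_measurable (lebesgue_on B)" and M: "AE x in lebesgue_on B. norm (u x) \<le> M"
    and p: "p \<ge> 1" and s: "s > 0"
  shows "norm (set_avg u E - c)
    \<le> s + s powr (1 - p) * ((1 / measure lebesgue E) * (\<integral>x. norm (u x - c) powr p \<partial>lebesgue_on B))"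
proof -
  have El: "E \<in> lmeasurable" using B E by (meson fmeasurableI2)
  interpret finite_measure "lebesgue_on E" by (rule finite_measure_lebesgue_on[OF El])
  have B': "B \<in> sets lebesgue" using B by auto
  have mE: "measure (lebesgue_on E) E = measure lebesgue E" using E by (simp add: measure_restrict_space)
  have umE: "u \<in> borel_measurable (lebesgue_on E)" using measurable_restrict_mono[OF um E(2)] .
  have ME: "AE x in lebesgue_on E. norm (u x) \<le> M" by (rule AE_lebesgue_on_subset[OF M E(2,1) B'])
  have i: "integrable (lebesgue_on E) u" by (rule integrable_bounded_lebesgue_on[OF El umE ME])
  have ip: "integrable (lebesgue_on B) (\<lambda>x. norm (u x - c) powr p)"
    using p by (intro integrable_bounded_powr[OF B um M]) simp
  have ipE: "integrable (lebesgue_on E) (\<lambda>x. norm (u x - c) powr p)"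
    by (rule integrable_lebesgue_on_subset[OF ip E(2,1) B'])
  have pt: "a \<le> s + s powr (1 - p) * a powr p" if "a \<ge> 0" for a :: real
  proof (cases "a \<le> s")
    case True
    then show ?thesis using s by (meson add_increasing2 mult_nonneg_nonneg powr_ge_zero)
  next
    case False
    then have "a = a powr (1 - p) * a powr p" using s by (simp add: powr_add[symmetric])
    also have "\<dots> \<le> s powr (1 - p) * a powr p"
      using False s p by (intro mult_right_mono powr_mono2') auto
    finally show ?thesis using s by linarith
  qed
  have "set_avg u E - c = (1 / measure lebesgue E) *\<^sub>R (\<integral>x. u x - c \<partial>lebesgue_on E)"
    using i E(3) by (simp add: set_avg_def scaleR_diff_right mE)
  also have "norm \<dots> = (1 / measure lebesgue E) * norm (\<integral>x. u x - c \<partial>lebesgue_on E)"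
    by simp
  also have "\<dots> \<le> (1 / measure lebesgue E) * (\<integral>x. s + s powr (1 - p) * norm (u x - c) powr p \<partial>lebesgue_on E)"
  proof (rule mult_left_mono)
    have "norm (\<integral>x. u x - c \<partial>lebesgue_on E) \<le> (\<integral>x. norm (u x - c) \<partial>lebesgue_on E)"
      by (rule integral_norm_bound)
    also have "\<dots> \<le> (\<integral>x. s + s powr (1 - p) * norm (u x - c) powr p \<partial>lebesgue_on E)"
      using i ipE by (intro integral_mono pt) auto
    finally show "norm (\<integral>x. u x - c \<partial>lebesgue_on E)
      \<le> (\<integral>x. s + s powr (1 - p) * norm (u x - c) powr p \<partial>lebesgue_on E)" .
  qed (use E in auto)
  also have "\<dots> = s + s powr (1 - p) * ((1 / measure lebesgue E) * (\<integral>x. norm (u x - c) powr p \<partial>lebesgue_on E))"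
    using E(3) ipE by (simp add: mE field_simps)
  also have "\<dots> \<le> s + s powr (1 - p) * ((1 / measure lebesgue E) * (\<integral>x. norm (u x - c) powr p \<partial>lebesgue_on B))"
    using E by (intro add_left_mono mult_left_mono integral_lebesgue_on_mono_set[OF ip E(2,1) B']) auto
  finally show ?thesis .
qed

text \<open>Both averages are close to one constant \<open>c\<close> that is nearly optimal on the
  ball. Corners and sides may differ, so the same estimate serves successive scales at one point and
  two points at one scale. The volume of the ball divided by that of a cube is at most
  \<open>\<omega> / \<tau> ^ DIM('a)\<close>.\<close>

lemma set_avg_cube_diff_le:
  fixes u :: "'a::euclidean_space \<Rightarrow> 'b::euclidean_space"
  defines "\<omega> \<equiv> unit_ball_vol (real DIM('a))"
  assumes um: "u \<in> borel_measurable (lebesgue_on (ball x r))"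
    and M: "AE x in lebesgue_on (ball x r). norm (u x) \<le> M"
    and p: "p \<ge> 1" and r: "r > 0" and \<tau>: "\<tau> > 0" and L: "L \<ge> 0"
    and osc: "oscillation p u (ball x r) < L * r powr (p * \<eta>)"
    and E: "cube y h \<subseteq> ball x r" "h \<ge> \<tau> * r" and F: "cube z k \<subseteq> ball x r" "k \<ge> \<tau> * r"
  shows "norm (set_avg u (cube y h) - set_avg u (cube z k))
    \<le> 2 * (1 + \<omega> * L / \<tau> ^ DIM('a)) * r powr \<eta>"
proof -
  let ?B = "ball x r" and ?D = "DIM('a)"
  have mB: "measure lebesgue ?B = \<omega> * r ^ ?D"
    using r by (simp add: content_ball \<omega>_def measure_completion)
  have \<omega>: "\<omega> > 0" unfolding \<omega>_def by simp
  obtain c where c: "1 / measure lebesgue ?B * (\<integral>y. norm (u y - c) powr p \<partial>lebesgue_on ?B) < L * r powr (p * \<eta>)"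
  proof -
    have "\<exists>c. 1 / measure lebesgue ?B * (\<integral>y. norm (u y - c) powr p \<partial>lebesgue_on ?B) < L * r powr (p * \<eta>)"
      using osc unfolding oscillation_def
      by (subst (asm) cINF_less_iff) (auto intro!: bdd_belowI2[of _ 0] Bochner_Integration.integral_nonneg)
    then show ?thesis using that by blast
  qed
  define J where "J = (\<integral>y. norm (u y - c) powr p \<partial>lebesgue_on ?B)"
  have J0: "J \<ge> 0" unfolding J_def by (intro Bochner_Integration.integral_nonneg) auto
  have J: "J \<le> \<omega> * r ^ ?D * (L * r powr (p * \<eta>))"
    using c \<omega> r unfolding J_def mB by (simp add: field_simps)
  have *: "norm (set_avg u (cube z k) - c) \<le> (1 + \<omega> * L / \<tau> ^ ?D) * r powr \<eta>"
    if sub: "cube z k \<subseteq> ?B" and k: "k \<ge> \<tau> * r" for z k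
  proof -
    have k0: "k > 0" using k \<tau> r by (meson mult_pos_pos order_less_le_trans)
    have mk: "measure lebesgue (cube z k) = k ^ ?D" using k0 by (simp add: measure_cube)
    \<comment> \<open>The free parameter is set to \<open>r powr \<eta>\<close>, which balances the
      two terms: \<open>(r powr \<eta>) powr (1 - p) * r powr (p * \<eta>)\<close> is again
      \<open>r powr \<eta>\<close>.\<close>
    have "norm (set_avg u (cube z k) - c) \<le> r powr \<eta> + (r powr \<eta>) powr (1 - p) * ((1 / k ^ ?D) * J)"
      using norm_set_avg_diff_le[OF _ _ sub _ um M p, of "r powr \<eta>" c] r k0
      by (simp add: mk J_def)
    also have "(r powr \<eta>) powr (1 - p) * ((1 / k ^ ?D) * J)
        \<le> (r powr \<eta>) powr (1 - p) * ((1 / (\<tau> * r) ^ ?D) * (\<omega> * r ^ ?D * (L * r powr (p * \<eta>))))"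
      using J J0 k k0 \<tau> r by (intro mult_left_mono mult_mono frac_le power_mono) auto
    also have "\<dots> = \<omega> * L / \<tau> ^ ?D * ((r powr \<eta>) powr (1 - p) * r powr (p * \<eta>))"
      using r \<tau> by (simp add: field_simps)
    also have "(r powr \<eta>) powr (1 - p) * r powr (p * \<eta>) = r powr \<eta>"
      by (simp add: powr_powr powr_add[symmetric] algebra_simps)
    finally show ?thesis by (simp add: algebra_simps)
  qed
  have "norm (set_avg u (cube y h) - set_avg u (cube z k))
      \<le> norm (set_avg u (cube y h) - c) + norm (set_avg u (cube z k) - c)"
    by (metis dist_norm dist_triangle2)
  also have "\<dots> \<le> (1 + \<omega> * L / \<tau> ^ ?D) * r powr \<eta> + (1 + \<omega> * L / \<tau> ^ ?D) * r powr \<eta>"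
    by (rule add_mono[OF *[OF E] *[OF F]])
  finally show ?thesis by (simp only: distrib_right mult_2)
qed

text \<open>The increments telescope and are dominated by a geometric series, whose tail gives the
  rate. Control is asked only from \<open>k0\<close> on, since coarser cubes may leave the
  domain.\<close>

lemma geometric_increments_limit:
  fixes a :: "nat \<Rightarrow> 'b::banach"
  assumes "0 < q" "q < 1" and inc: "\<And>k. k \<ge> k0 \<Longrightarrow> norm (a (Suc k) - a k) \<le> D * q ^ k"
  shows "convergent a" and "norm (lim a - a k0) \<le> D * q ^ k0 / (1 - q)"
proof -
  define d where "d j = a (Suc (j + k0)) - a (j + k0)" for j
  have dle: "norm (d j) \<le> D * q ^ k0 * q ^ j" for j
    using inc[of "j + k0"] by (simp add: d_def power_add mult_ac)
  have gs: "(\<lambda>j. D * q ^ k0 * q ^ j) sums (D * q ^ k0 * (1 / (1 - q)))"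
    using assms by (intro sums_mult geometric_sums) auto
  have sd: "summable (\<lambda>j. norm (d j))"
    by (rule summable_comparison_test'[OF sums_summable[OF gs], of 0]) (simp only: real_norm_def abs_norm_cancel dle)
  have tele: "(\<Sum>j<n. d j) = a (n + k0) - a k0" for n
    by (induction n) (simp_all add: d_def)
  have "(\<lambda>n. \<Sum>j<n. d j) \<longlonglongrightarrow> suminf d"
    using summable_LIMSEQ[OF summable_norm_cancel[OF sd]] .
  then have "(\<lambda>n. a (n + k0) - a k0 + a k0) \<longlonglongrightarrow> suminf d + a k0"
    unfolding tele by (rule tendsto_add) (rule tendsto_const)
  then have "(\<lambda>n. a (n + k0)) \<longlonglongrightarrow> suminf d + a k0"
    by (simp only: diff_add_cancel)
  then have lim: "a \<longlonglongrightarrow> suminf d + a k0"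
    by (rule LIMSEQ_offset)
  then show "convergent a" by (rule convergentI)
  have "norm (lim a - a k0) = norm (suminf d)" using limI[OF lim] by simp
  also have "\<dots> \<le> (\<Sum>j. norm (d j))" by (rule summable_norm[OF sd])
  also have "\<dots> \<le> (\<Sum>j. D * q ^ k0 * q ^ j)"
    by (rule suminf_le[OF dle sd sums_summable[OF gs]])
  also have "\<dots> = D * q ^ k0 / (1 - q)" using sums_unique[OF gs] by simp
  finally show "norm (lim a - a k0) \<le> D * q ^ k0 / (1 - q)" .
qed

section \<open>Campanato's estimate\<close>

text \<open>The first exponent with \<open>q ^ k \<le> t\<close> works, because its predecessor
  still exceeds \<open>t\<close>. When that exponent is \<open>0\<close> there is no predecessor,
  and \<open>t * q \<le> 1\<close> takes over.\<close>

lemma geometric_scale: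
  fixes q t :: real
  assumes "0 < q" "q < 1" "0 < t" "t * q \<le> 1"
  obtains k where "q ^ k \<le> t" "t * q \<le> q ^ k"
proof -
  define k where "k = (LEAST k. q ^ k \<le> t)"
  obtain k0 where "q ^ k0 < t"
    using real_arch_pow_inv[of t q] assms by auto
  then have k: "q ^ k \<le> t"
    unfolding k_def by (rule LeastI[of "\<lambda>k. q ^ k \<le> t" k0, OF less_imp_le])
  have "t * q \<le> q ^ k"
  proof (cases k)
    case 0
    then show ?thesis using assms by simp
  next
    case (Suc j)
    then have "j < k" by simp
    then have "\<not> q ^ j \<le> t" unfolding k_def by (rule not_less_Least)
    then have "t * q \<le> q ^ j * q" using assms by (intro mult_right_mono) auto
    then show ?thesis by (simp add: Suc mult.commute)
  qed
  with k that show ?thesis by blast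
qed

lemma power_powr_swap:
  fixes a :: real
  assumes "a > 0"
  shows "(a ^ k) powr \<eta> = (a powr \<eta>) ^ k"
proof -
  have "(a ^ k) powr \<eta> = (a powr real k) powr \<eta>" using assms by (simp only: powr_realpow)
  also have "\<dots> = (a powr \<eta>) powr real k" by (simp only: powr_powr mult.commute)
  also have "\<dots> = (a powr \<eta>) ^ k" by (rule powr_realpow) (use assms in simp)
  finally show ?thesis .
qed

text \<open>Points with \<open>P * dist x y \<le> R\<close> are compared at the dyadic scale of
  their distance: the two tails of the averages and one comparison of neighbouring cubes give
  \<open>1 + 2 / (1 - (1 / 2) powr \<eta>)\<close>. For more distant points the trivial bound
  \<open>2 * M\<close> suffices, because \<open>(P * dist x y / R) powr \<eta>\<close> is then at
  least \<open>1\<close>.\<close>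

lemma campanato:
  fixes u :: "'a::euclidean_space \<Rightarrow> 'b::euclidean_space" and P A M L p \<eta> R :: real
  defines "P \<equiv> real DIM('a) + 3"
  defines "A \<equiv> 2 * (1 + unit_ball_vol (real DIM('a)) * L / (1 / (2 * P)) ^ DIM('a))"
  assumes um: "u \<in> borel_measurable (lebesgue_on (ball 0 1))"
    and M: "AE x in lebesgue_on (ball 0 1). norm (u x) \<le> M" "M \<ge> 0"
    and p: "p \<ge> 1" and \<eta>: "\<eta> > 0" and L: "L \<ge> 0" and R: "R > 0"
    and balls: "\<And>x. x \<in> K \<Longrightarrow> ball x R \<subseteq> ball 0 1"
    and osc: "\<And>x r. x \<in> K \<Longrightarrow> 0 < r \<Longrightarrow> r \<le> R \<Longrightarrow> oscillation p u (ball x r) < L * r powr (p * \<eta>)"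
    and xy: "x \<in> K" "y \<in> K"
  shows "dist (cube_limit u x) (cube_limit u y)
    \<le> (A * P powr \<eta> * (1 + 2 / (1 - (1 / 2) powr \<eta>)) + 2 * M * (P / R) powr \<eta>) * dist x y powr \<eta>"
proof -
  define h where "h k = (1 / 2 :: real) ^ k" for k
  define a where "a x k = set_avg u (cube x (h k))" for x k
  define q where "q = (1 / 2 :: real) powr \<eta>"
  have v: "cube_limit u x = lim (a x)" for x by (simp add: cube_limit_def a_def[abs_def] h_def)
  have P: "P > 3" unfolding P_def by simp
  have A: "A \<ge> 0" unfolding A_def using L P by (intro mult_nonneg_nonneg add_nonneg_nonneg divide_nonneg_nonneg) auto
  have h0: "h k > 0" for k by (simp add: h_def)
  have q: "0 < q" "q < 1" using \<eta> powr_less_mono2[of \<eta> "1 / 2 :: real" 1] by (auto simp: q_def)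
  have hq: "(P * h k) powr \<eta> = P powr \<eta> * q ^ k" for k
    using P by (simp add: h_def q_def powr_mult power_powr_swap del: power_divide power_one_over)
  have sub: "cube z (h k) \<subseteq> ball x (P * h k)" if "dist x z \<le> 2 * h k" for x z :: 'a and k
    using that h0[of k] by (intro cube_subset_ball[OF h0]) (simp add: P_def algebra_simps)
  have sub': "cube x (h (Suc k)) \<subseteq> ball x (P * h k)" for x :: 'a and k
  proof (rule cube_subset_ball[OF h0])
    have "real DIM('a) * h (Suc k) \<le> real DIM('a) * h k"
      by (intro mult_left_mono) (simp_all add: h_def)
    then show "dist x x + real DIM('a) * h (Suc k) < P * h k"
      using h0[of k] unfolding P_def distrib_right dist_self by linarith
  qed
  \<comment> \<open>The lower bound \<open>h k / 2\<close> admits the next finer cube. It equals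
    \<open>1 / (2 * P)\<close> times the radius \<open>P * h k\<close>, which is the value of
    \<open>\<tau>\<close> hidden in \<open>A\<close>.\<close>
  have diff: "norm (set_avg u (cube y (h i)) - set_avg u (cube z (h j))) \<le> A * P powr \<eta> * q ^ k"
    if x: "x \<in> K" and r: "P * h k \<le> R"
      and Y: "cube y (h i) \<subseteq> ball x (P * h k)" "h i \<ge> h k / 2"
      and Z: "cube z (h j) \<subseteq> ball x (P * h k)" "h j \<ge> h k / 2" for x y z i j k
  proof -
    have r0: "P * h k > 0" using P h0 by simp
    have B: "ball x (P * h k) \<subseteq> ball 0 1" using balls[OF x] subset_ball[OF r, of x] by blast
    have "norm (set_avg u (cube y (h i)) - set_avg u (cube z (h j))) \<le> A * (P * h k) powr \<eta>"
      unfolding A_def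
    proof (rule set_avg_cube_diff_le[OF _ _ p r0 _ L osc[OF x r0 r] Y(1) _ Z(1)])
      show "u \<in> borel_measurable (lebesgue_on (ball x (P * h k)))"
        by (rule measurable_restrict_mono[OF um B])
      show "AE x in lebesgue_on (ball x (P * h k)). norm (u x) \<le> M"
        by (rule AE_lebesgue_on_subset[OF M(1) B]) auto
    qed (use P Y Z in auto)
    then show ?thesis by (simp only: hq mult.assoc)
  qed
  have lim: "convergent (a x)" "norm (lim (a x) - a x k) \<le> A * P powr \<eta> * q ^ k / (1 - q)"
    if x: "x \<in> K" and k: "P * h k \<le> R" for x k
  proof -
    have inc: "norm (a x (Suc j) - a x j) \<le> A * P powr \<eta> * q ^ j" if "j \<ge> k" for j
    proof -
      have "h j \<le> h k" using that unfolding h_def by (intro power_decreasing) auto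
      then have "P * h j \<le> R" using k P by (meson mult_left_mono order_trans less_imp_le order_less_trans zero_less_numeral)
      then show ?thesis
        unfolding a_def using h0[of j] by (intro diff[OF x] sub sub') (auto simp: h_def)
    qed
    from geometric_increments_limit[of q k "a x", OF q inc]
    show "convergent (a x)" "norm (lim (a x) - a x k) \<le> A * P powr \<eta> * q ^ k / (1 - q)" by blast+
  qed
  obtain k0 where "(1 / 2) ^ k0 < R / P"
    using real_arch_pow_inv[of "R / P" "1 / 2"] R P by auto
  then have k0: "P * h k0 \<le> R" using P by (simp add: h_def field_simps)
  have bound: "norm (lim (a x)) \<le> M" if x: "x \<in> K" for x
  proof (rule LIMSEQ_le_const2)
    show "(\<lambda>k. norm (a x k)) \<longlonglongrightarrow> norm (lim (a x))"
      using lim(1)[OF x k0] by (intro tendsto_norm) (simp add: convergent_LIMSEQ_iff)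
    \<comment> \<open>From \<open>k0\<close> on the cubes lie in the unit ball, where
      \<open>u\<close> is bounded.\<close>
    have "norm (a x k) \<le> M" if "k \<ge> k0" for k
    proof -
      have "h k \<le> h k0" using that unfolding h_def by (intro power_decreasing) auto
      then have "P * h k \<le> R" using k0 P by (meson mult_left_mono order_trans less_imp_le order_less_trans zero_less_numeral)
      then have B: "cube x (h k) \<subseteq> ball 0 1"
        using balls[OF x] subset_ball[of "P * h k" R x] sub[of x x k] h0[of k] by auto
      show ?thesis unfolding a_def
      proof (rule norm_set_avg_le)
        show "u \<in> borel_measurable (lebesgue_on (cube x (h k)))"
          by (rule measurable_restrict_mono[OF um B])
        show "AE x in lebesgue_on (cube x (h k)). norm (u x) \<le> M"
          by (rule AE_lebesgue_on_subset[OF M(1) B]) auto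
        show "measure lebesgue (cube x (h k)) > 0"
          using h0[of k] by (simp add: measure_cube)
      qed simp
    qed
    then show "\<exists>N. \<forall>n\<ge>N. norm (a x n) \<le> M" by blast
  qed
  show ?thesis
  proof (cases "x = y")
    case True
    then show ?thesis by simp
  next
    case False
    define t where "t = dist x y"
    have t0: "t > 0" using False by (simp add: t_def)
    \<comment> \<open>Points of \<open>K\<close> are centres of balls inside the unit ball, so their
      distance is below \<open>2\<close>; this is what lets the choice of a dyadic scale start at
      side \<open>1\<close>.\<close>
    have "norm z < 1" if "z \<in> K" for z
      using subsetD[OF balls[OF that], of z] R by simp
    then have "norm x < 1" "norm y < 1" using xy by auto
    then have t2: "t < 2" using norm_triangle_ineq4[of x y] by (simp add: t_def dist_norm)
    define C1 where "C1 = A * P powr \<eta> * (1 + 2 / (1 - q))"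
    define C2 where "C2 = 2 * M * (P / R) powr \<eta>"
    have C1: "C1 \<ge> 0" unfolding C1_def using A q by (intro mult_nonneg_nonneg add_nonneg_nonneg) auto
    have C2: "C2 \<ge> 0" unfolding C2_def using M by simp
    have "dist (lim (a x)) (lim (a y)) \<le> (C1 + C2) * t powr \<eta>"
    proof (cases "P * t \<le> R")
      case True
      have t': "t * (1 / 2) \<le> 1" using t2 by simp
      obtain k where k': "(1 / 2) ^ k \<le> t" "t * (1 / 2) \<le> (1 / 2) ^ k"
        by (rule geometric_scale[OF _ _ t0 t']) simp_all
      then have k: "h k \<le> t" "t \<le> 2 * h k" unfolding h_def by linarith+
      have kR: "P * h k \<le> R" using k True P by (meson mult_left_mono order_trans less_imp_le order_less_trans zero_less_numeral)
      have "q ^ k = h k powr \<eta>" unfolding q_def h_def by (simp only: power_powr_swap[of "1 / 2"] half_gt_zero_iff zero_less_one)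
      then have qk: "q ^ k \<le> t powr \<eta>" using k h0[of k] \<eta> by (simp add: powr_mono2)
      \<comment> \<open>Since \<open>t \<le> 2 * h k\<close>, the cube at \<open>y\<close> still
        lies in the ball around \<open>x\<close> of radius \<open>P * h k\<close>.\<close>
      have 1: "norm (a x k - a y k) \<le> A * P powr \<eta> * q ^ k"
        unfolding a_def using k h0[of k] by (intro diff[OF xy(1) kR] sub) (auto simp: t_def)
      have "dist (lim (a x)) (lim (a y)) \<le> norm (lim (a x) - a x k) + norm (a x k - a y k) + norm (lim (a y) - a y k)"
        using norm_triangle_ineq4[of "lim (a x) - a x k + (a x k - a y k)" "lim (a y) - a y k"]
          norm_triangle_ineq[of "lim (a x) - a x k" "a x k - a y k"] by (simp add: dist_norm)
      also have "\<dots> \<le> A * P powr \<eta> * q ^ k / (1 - q) + A * P powr \<eta> * q ^ k + A * P powr \<eta> * q ^ k / (1 - q)"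
        by (intro add_mono lim(2)[OF _ kR] xy 1)
      also have "\<dots> = C1 * q ^ k" unfolding C1_def divide_inverse by algebra
      also have "\<dots> \<le> (C1 + C2) * t powr \<eta>" using qk C1 C2 q(1) by (intro mult_mono) auto
      finally show ?thesis .
    next
      case False
      have "1 \<le> (P * t / R) powr \<eta>"
        using False R \<eta> by (intro ge_one_powr_ge_zero) auto
      also have "\<dots> = (P / R) powr \<eta> * t powr \<eta>"
        using P R t0 by (simp add: powr_mult[symmetric])
      finally have one: "1 \<le> (P / R) powr \<eta> * t powr \<eta>" .
      have "dist (lim (a x)) (lim (a y)) \<le> 2 * M * 1"
        using bound[OF xy(1)] bound[OF xy(2)] norm_triangle_ineq4[of "lim (a x)" "lim (a y)"]
        by (simp add: dist_norm)
      also have "\<dots> \<le> 2 * M * ((P / R) powr \<eta> * t powr \<eta>)"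
        using one M by (intro mult_left_mono) auto
      also have "\<dots> = C2 * t powr \<eta>" by (simp add: C2_def)
      also have "\<dots> \<le> (C1 + C2) * t powr \<eta>" using C1 by (intro mult_right_mono) auto
      finally show ?thesis .
    qed
    then show ?thesis unfolding v C1_def C2_def q_def t_def .
  qed
qed

text \<open>Extending \<open>u\<close> by zero gives a function integrable on the whole space, to
  which the differentiation theorem applies. Around a point of the open ball, small cubes stay
  inside, so the extension does not change their averages.\<close>

lemma cube_limit_eq_AE:
  fixes u :: "'a::euclidean_space \<Rightarrow> 'b::euclidean_space"
  assumes um: "u \<in> borel_measurable (lebesgue_on (ball 0 1))"
    and M: "AE x in lebesgue_on (ball 0 1). norm (u x) \<le> M"
  shows "AE x in lebesgue_on (ball 0 1). cube_limit u x = u x"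
proof -
  define f where "f x = indicator (ball 0 1) x *\<^sub>R u x" for x
  have ui: "integrable (lebesgue_on (ball 0 1)) u"
    by (rule integrable_bounded_lebesgue_on[OF _ um M]) simp
  then have fi: "integrable lebesgue f"
    unfolding f_def[abs_def] by (subst (asm) integrable_restrict_space) auto
  have "f integrable_on cbox a b" for a b
    using fi by (metis integrable_on_lebesgue integrable_on_superset integrable_on_subcbox subset_UNIV)
  then obtain N where N: "negligible N" "\<And>x e. \<lbrakk>x \<notin> N; 0 < e\<rbrakk> \<Longrightarrow>
      \<exists>d>0. \<forall>h. 0 < h \<and> h < d \<longrightarrow> norm (integral (cbox x (x + h *\<^sub>R One)) f /\<^sub>R h ^ DIM('a) - f x) < e"
    using integrable_ccontinuous_explicit[of f] by blast
  have eq: "cube_limit u x = u x" if x: "x \<in> ball 0 1" "x \<notin> N" for x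
  proof -
    have h0: "(\<lambda>k. (1 / 2 :: real) ^ k) \<longlonglongrightarrow> 0" by (rule LIMSEQ_power_zero) simp
    obtain r where r: "r > 0" "ball x r \<subseteq> ball 0 1"
      using x(1) open_ball openE by blast
    have ev: "\<forall>\<^sub>F k in sequentially. (1 / 2 :: real) ^ k < d" if "d > 0" for d
      using order_tendstoD(2)[OF h0 that] .
    have avg: "set_avg u (cube x h) = integral (cbox x (x + h *\<^sub>R One)) f /\<^sub>R h ^ DIM('a)"
      if h: "0 < h" "h < r / (real DIM('a) + 1)" for h
    proof -
      have sub: "cube x h \<subseteq> ball 0 1"
        using cube_subset_ball[of h x x r] h r by (auto simp: field_simps)
      have "(\<integral>y. u y \<partial>lebesgue_on (cube x h)) = (\<integral>y. f y \<partial>lebesgue_on (cube x h))"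
        using sub by (intro Bochner_Integration.integral_cong) (auto simp: f_def)
      also have "\<dots> = integral (cube x h) f"
        using integrable_lebesgue_on_subset[of UNIV f "cube x h"] fi
        by (intro lebesgue_integral_eq_integral) (auto simp: lebesgue_on_UNIV_eq)
      finally show ?thesis using h by (simp add: set_avg_def measure_cube) (simp add: cube_def divide_inverse)
    qed
    have "(\<lambda>k. set_avg u (cube x ((1 / 2) ^ k))) \<longlonglongrightarrow> f x"
    proof (rule tendstoI)
      fix e :: real assume "e > 0"
      then obtain d where d: "d > 0" "\<And>h. 0 < h \<Longrightarrow> h < d \<Longrightarrow>
          norm (integral (cbox x (x + h *\<^sub>R One)) f /\<^sub>R h ^ DIM('a) - f x) < e"
        using N(2)[OF x(2)] by meson
      have r': "r / (real DIM('a) + 1) > 0" using r by simp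
      show "\<forall>\<^sub>F k in sequentially. dist (set_avg u (cube x ((1 / 2) ^ k))) (f x) < e"
        using ev[OF d(1)] ev[OF r']
      proof eventually_elim
        case (elim k)
        show ?case unfolding dist_norm
          by (subst avg) (use elim d(2)[of "(1 / 2) ^ k"] in auto)
      qed
    qed
    then show ?thesis using x by (simp add: cube_limit_def limI f_def)
  qed
  have "N \<in> null_sets lebesgue" using N(1) by (simp add: negligible_iff_null_sets)
  then have "AE x in lebesgue. x \<notin> N" by (rule AE_not_in)
  then show ?thesis
    using eq by (subst AE_restrict_space_iff) (auto elim!: eventually_mono)
qed

section \<open>Iteration, oscillations and norms\<close>

text \<open>Along \<open>s * \<theta> ^ k\<close> the bound \<open>K * (\<theta> powr e) ^ k\<close>
  reproduces itself as soon as \<open>\<gamma> * K + b \<le> K * \<theta> powr e\<close>. The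
  summand \<open>b / (\<theta> powr e - \<gamma>)\<close> of \<open>K\<close> secures this, and
  \<open>\<Psi>\<close> covers the start of the induction.\<close>

lemma geometric_decay_bound:
  fixes \<psi> :: "real \<Rightarrow> real"
  assumes \<theta>: "0 < \<theta>" "\<theta> < 1" and R: "0 < R" "R \<le> 1" and e: "e > 0"
    and \<gamma>: "0 \<le> \<gamma>" "\<gamma> < \<theta> powr e" and b: "b \<ge> 0" and \<psi>0: "\<Psi> \<ge> 0"
    and bnd: "\<And>r. 0 < r \<Longrightarrow> r \<le> R \<Longrightarrow> \<psi> r \<le> \<Psi>"
    and decay: "\<And>r. 0 < r \<Longrightarrow> r \<le> R \<Longrightarrow> \<psi> (r * \<theta>) \<le> \<gamma> * \<psi> r + b * r powr e"
    and r: "0 < r" "r \<le> R"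
  shows "\<psi> r < (\<Psi> + b / (\<theta> powr e - \<gamma>) + 1) * (\<theta> * R) powr (- e) * r powr e"
proof -
  define K where "K = \<Psi> + b / (\<theta> powr e - \<gamma>)"
  have K0: "K \<ge> 0" using assms by (simp add: K_def)
  have Kb: "\<gamma> * K + b \<le> K * \<theta> powr e"
  proof -
    have "b \<le> K * (\<theta> powr e - \<gamma>)"
      using \<gamma> \<psi>0 by (simp add: K_def distrib_right)
    then show ?thesis by (simp add: algebra_simps)
  qed
  have iter: "\<psi> (s * \<theta> ^ k) \<le> K * (\<theta> powr e) ^ k" if s: "0 < s" "s \<le> R" for s k
  proof (induction k)
    case 0
    have "\<psi> s \<le> \<Psi>" by (rule bnd[OF s])
    also have "\<Psi> \<le> K" using \<gamma> b by (simp add: K_def)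
    finally show ?case by simp
  next
    case (Suc k)
    have "s * \<theta> ^ k \<le> R * 1" using s \<theta> R by (intro mult_mono power_le_one) auto
    then have sk: "0 < s * \<theta> ^ k" "s * \<theta> ^ k \<le> R" using s \<theta> by auto
    have "(s * \<theta> ^ k) powr e \<le> (\<theta> ^ k) powr e"
      using s \<theta> R e by (intro powr_mono2) (auto intro: mult_left_le_one_le)
    then have pk: "(s * \<theta> ^ k) powr e \<le> (\<theta> powr e) ^ k" using \<theta> by (simp add: power_powr_swap)
    have "\<psi> (s * \<theta> ^ k * \<theta>) \<le> \<gamma> * \<psi> (s * \<theta> ^ k) + b * (s * \<theta> ^ k) powr e"
      by (rule decay[OF sk])
    also have "\<dots> \<le> \<gamma> * (K * (\<theta> powr e) ^ k) + b * (\<theta> powr e) ^ k"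
      using Suc.IH pk \<gamma> b by (intro add_mono mult_left_mono) auto
    also have "\<dots> = (\<gamma> * K + b) * (\<theta> powr e) ^ k" by (simp add: algebra_simps)
    also have "\<dots> \<le> (K * \<theta> powr e) * (\<theta> powr e) ^ k"
      using Kb by (intro mult_right_mono) auto
    finally show ?case by (simp add: mult_ac)
  qed
  \<comment> \<open>Every radius \<open>r \<le> R\<close> is \<open>s * \<theta> ^ k\<close> for
    some \<open>s\<close> between \<open>\<theta> * R\<close> and \<open>R\<close>; the lower end of
    this range produces the factor \<open>(\<theta> * R) powr (- e)\<close>.\<close>
  obtain k where k: "\<theta> ^ k \<le> r / (R * \<theta>)" "r / (R * \<theta>) * \<theta> \<le> \<theta> ^ k"
    using geometric_scale[of \<theta> "r / (R * \<theta>)"] \<theta> R r by auto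
  define s where "s = r / \<theta> ^ k"
  have s: "0 < s" "s \<le> R" "\<theta> * R \<le> s"
    using k \<theta> R r by (auto simp: s_def field_simps)
  have rs: "r = s * \<theta> ^ k" using \<theta> by (simp add: s_def)
  have "\<psi> r \<le> K * (\<theta> powr e) ^ k" unfolding rs by (rule iter[OF s(1,2)])
  also have "(\<theta> powr e) ^ k = s powr (- e) * r powr e"
    unfolding rs using s \<theta> by (simp add: powr_mult power_powr_swap powr_minus field_simps)
  also have "K * (s powr (- e) * r powr e) \<le> K * ((\<theta> * R) powr (- e) * r powr e)"
    using s \<theta> R e K0 by (intro mult_left_mono mult_right_mono powr_mono2') auto
  \<comment> \<open>Adding \<open>1\<close> makes the bound strict even when \<open>K\<close> is
    zero.\<close>
  also have "\<dots> < (K + 1) * ((\<theta> * R) powr (- e) * r powr e)"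
    using \<theta> R r by (intro mult_strict_right_mono mult_pos_pos) auto
  finally show ?thesis by (simp add: K_def mult.assoc)
qed

text \<open>The Jacobian cancels against the ratio of the volumes, so the averages agree for each
  constant \<open>c\<close> separately.\<close>

lemma oscillation_scale:
  fixes u :: "'a::euclidean_space \<Rightarrow> 'b::euclidean_space"
  assumes "r > 0" "s > 0" and um: "u \<in> borel_measurable (lebesgue_on (ball x0 (r * s)))"
  shows "oscillation p (\<lambda>y. u (x0 + r *\<^sub>R y)) (ball 0 s) = oscillation p u (ball x0 (r * s))"
proof -
  have "1 / measure lebesgue (ball (0::'a) s) * (\<integral>y. norm (u (x0 + r *\<^sub>R y) - c) powr p \<partial>lebesgue_on (ball 0 s))
      = 1 / measure lebesgue (ball x0 (r * s)) * (\<integral>y. norm (u y - c) powr p \<partial>lebesgue_on (ball x0 (r * s)))" for c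
  proof -
    have "(\<lambda>y. norm (u y - c) powr p) \<in> borel_measurable (lebesgue_on (ball x0 (r * s)))"
      using um by measurable
    from integral_ball_affine[OF assms(1) this] show ?thesis
      using assms by (simp add: measure_completion content_ball power_mult_distrib power_divide)
  qed
  then show ?thesis unfolding oscillation_def by simp
qed

lemma oscillation_cong_AE:
  fixes u :: "'a::euclidean_space \<Rightarrow> 'b::euclidean_space"
  assumes "AE x in lebesgue_on B. u x = u' x"
    and "u \<in> borel_measurable (lebesgue_on B)" "u' \<in> borel_measurable (lebesgue_on B)"
  shows "oscillation p u B = oscillation p u' B"
proof -
  have "(\<integral>y. norm (u y - c) powr p \<partial>lebesgue_on B) = (\<integral>y. norm (u' y - c) powr p \<partial>lebesgue_on B)" for c
    using assms by (intro integral_cong_AE) (measurable, auto elim!: eventually_mono)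
  then show ?thesis unfolding oscillation_def by simp
qed

text \<open>The constant \<open>0\<close> is a competitor in the infimum. The result starts the
  iteration.\<close>

lemma oscillation_bounded:
  fixes u :: "'a::euclidean_space \<Rightarrow> 'b::euclidean_space"
  assumes B: "B \<in> lmeasurable" "measure lebesgue B > 0" and um: "u \<in> borel_measurable (lebesgue_on B)"
    and M: "AE x in lebesgue_on B. norm (u x) \<le> M" and p: "p \<ge> 0"
  shows "oscillation p u B \<le> M powr p"
proof -
  interpret finite_measure "lebesgue_on B" by (rule finite_measure_lebesgue_on[OF B(1)])
  have "oscillation p u B \<le> 1 / measure lebesgue B * (\<integral>y. norm (u y - 0) powr p \<partial>lebesgue_on B)"
    unfolding oscillation_def
    by (intro cINF_lower bdd_belowI2[of _ 0]) (auto intro!: Bochner_Integration.integral_nonneg)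
  also have "\<dots> \<le> 1 / measure lebesgue B * (\<integral>y. M powr p \<partial>lebesgue_on B)"
  proof (intro mult_left_mono integral_mono_AE)
    show "integrable (lebesgue_on B) (\<lambda>y. norm (u y - 0) powr p)"
      by (rule integrable_bounded_powr[OF B(1) um M p])
    show "AE y in lebesgue_on B. norm (u y - 0) powr p \<le> M powr p"
      using M by eventually_elim (use p in \<open>auto intro: powr_mono2\<close>)
  qed (use B in auto)
  also have "\<dots> = M powr p"
    using B by (simp add: measure_restrict_space fmeasurable_def)
  finally show ?thesis .
qed

section \<open>Essential suprema, Hoelder seminorms and the distance to the boundary\<close>

lemma Linf_norm_le:
  assumes "f \<in> borel_measurable (lebesgue_on U)" "AE x in lebesgue_on U. norm (f x) \<le> c" "c \<ge> 0"
  shows "Linf_norm U f \<le> c"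
proof -
  have "esssup (lebesgue_on U) (\<lambda>x. ereal (norm (f x))) \<le> ereal c"
    using assms by (intro esssup_I) auto
  then show ?thesis
    unfolding Linf_norm_def using assms(3)
    by (cases "esssup (lebesgue_on U) (\<lambda>x. ereal (norm (f x)))") auto
qed

lemma Linf_norm_nonneg:
  assumes "f \<in> borel_measurable (lebesgue_on (ball (0::'a::euclidean_space) 1))"
  shows "0 \<le> Linf_norm (ball 0 1) f"
proof -
  have "emeasure (lebesgue_on (ball (0::'a) 1)) (space (lebesgue_on (ball 0 1))) \<noteq> 0"
    by (simp add: emeasure_restrict_space emeasure_ball order_less_imp_not_eq2[OF unit_ball_vol_pos])
  then have "0 = esssup (lebesgue_on (ball (0::'a) 1)) (\<lambda>x. 0 :: ereal)"
    by (simp add: esssup_const)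
  also have "\<dots> \<le> esssup (lebesgue_on (ball 0 1)) (\<lambda>x. ereal (norm (f x)))"
    by (rule esssup_mono) auto
  finally show ?thesis by (simp add: Linf_norm_def real_of_ereal_pos)
qed

lemma AE_le_Linf_norm:
  assumes "f \<in> Linf_space U"
  shows "AE x in lebesgue_on U. norm (f x) \<le> Linf_norm U f"
  using esssup_AE[of "\<lambda>x. ereal (norm (f x))" "lebesgue_on U"]
proof eventually_elim
  case (elim x)
  then show ?case
    using assms unfolding Linf_space_def Linf_norm_def
    by (cases "esssup (lebesgue_on U) (\<lambda>x. ereal (norm (f x)))") auto
qed

lemma holder_seminormD:
  assumes "holder_seminorm \<eta> K f < \<infinity>" "x \<in> K" "y \<in> K"
  shows "dist (f x) (f y) \<le> enn2real (holder_seminorm \<eta> K f) * dist x y powr \<eta>"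
proof (cases "x = y")
  case False
  have "ennreal (dist (f x) (f y) / dist x y powr \<eta>) \<le> holder_seminorm \<eta> K f"
    unfolding holder_seminorm_def using assms(2,3) by (meson SUP_upper2 order_refl)
  then have "dist (f x) (f y) / dist x y powr \<eta> \<le> enn2real (holder_seminorm \<eta> K f)"
    using assms(1) by (metis enn2real_ennreal enn2real_mono divide_nonneg_nonneg infinity_ennreal_def powr_ge_zero zero_le_dist)
  then show ?thesis using False by (simp add: field_simps)
qed simp

lemma holder_seminorm_leI:
  assumes "\<And>x y. x \<in> K \<Longrightarrow> y \<in> K \<Longrightarrow> dist (f x) (f y) \<le> C * dist x y powr \<eta>"
  shows "holder_seminorm \<eta> K f \<le> ennreal C"
  unfolding holder_seminorm_def
proof (intro SUP_least)
  fix x y assume xy: "x \<in> K" "y \<in> K"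
  show "ennreal (dist (f x) (f y) / dist x y powr \<eta>) \<le> ennreal C"
  proof (cases "x = y")
    case False
    then show ?thesis using assms[OF xy] by (intro ennreal_leI) (simp add: field_simps)
  qed simp
qed

lemma holder_continuous_on:
  assumes "holder_seminorm \<eta> K f < \<infinity>" "\<eta> > 0"
  shows "continuous_on K f"
  unfolding continuous_on_def
proof
  fix x assume x: "x \<in> K"
  have "((\<lambda>y. dist y x) \<longlongrightarrow> 0) (at x within K)"
    using tendsto_dist[OF tendsto_ident_at tendsto_const, of x x K] by simp
  then have "((\<lambda>y. dist y x powr \<eta>) \<longlongrightarrow> 0) (at x within K)"
    using assms(2) by (intro tendsto_zero_powrI[OF _ tendsto_const]) auto
  then have lim: "((\<lambda>y. enn2real (holder_seminorm \<eta> K f) * dist y x powr \<eta>) \<longlongrightarrow> 0) (at x within K)"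
    by (rule tendsto_mult_right_zero)
  have "((\<lambda>y. dist (f y) (f x)) \<longlongrightarrow> 0) (at x within K)"
  proof (rule tendsto_sandwich[OF _ _ tendsto_const lim])
    show "\<forall>\<^sub>F y in at x within K. dist (f y) (f x) \<le> enn2real (holder_seminorm \<eta> K f) * dist y x powr \<eta>"
      unfolding eventually_at_filter
      using holder_seminormD[OF assms(1) _ x] by (auto intro!: always_eventually)
  qed simp
  then show "(f \<longlongrightarrow> f x) (at x within K)" by (subst tendsto_dist_iff)
qed

text \<open>A segment from a point of \<open>U\<close> to a point outside meets the frontier, at a
  point no farther away than the end of the segment.\<close>

lemma ball_setdist_frontier_subset:
  fixes x :: "'a::euclidean_space"
  assumes "x \<in> K" "K \<subseteq> U"
  shows "ball x (setdist K (frontier U)) \<subseteq> U"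
proof
  fix y assume y: "y \<in> ball x (setdist K (frontier U))"
  show "y \<in> U"
  proof (rule ccontr)
    assume "y \<notin> U"
    then have "closed_segment x y \<inter> frontier U \<noteq> {}"
      using assms by (intro connected_Int_frontier) auto
    then obtain z where z: "z \<in> closed_segment x y" "z \<in> frontier U" by blast
    have "setdist K (frontier U) \<le> dist x z" by (rule setdist_le_dist[OF assms(1) z(2)])
    also have "dist x z \<le> dist x y" using dist_in_closed_segment[OF z(1)] by (simp add: dist_commute)
    finally show False using y by simp
  qed
qed

section \<open>Rescaling the decay estimate\<close>

lemma admissible_measurable:
  assumes "(u, \<Omega>, f, A) \<in> admissible_quadruples q ell \<Lambda> \<gamma>\<^sub>0" "0 < \<gamma>\<^sub>0"
  shows "u \<in> borel_measurable (lebesgue_on (ball 0 1))"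
    and "\<Omega> \<in> borel_measurable (lebesgue_on (ball 0 1))"
    and "f \<in> borel_measurable (lebesgue_on (ball 0 1))"
    and "A \<in> borel_measurable (lebesgue_on (ball 0 1))"
proof -
  have "continuous_on (cball 0 1) A"
    using assms by (intro holder_continuous_on) (auto simp: admissible_quadruples_def)
  then have "continuous_on (ball 0 1) A" by (rule continuous_on_subset[OF _ ball_subset_cball])
  then show "A \<in> borel_measurable (lebesgue_on (ball 0 1))"
    by (rule continuous_imp_measurable_on_sets_lebesgue) simp
qed (use assms in \<open>auto simp: admissible_quadruples_def H1_space_def Lp_space_def\<close>)

lemma Lp_norm_cong_AE:
  assumes "AE x in lebesgue_on U. f x = g x"
    and "f \<in> borel_measurable (lebesgue_on U)" "g \<in> borel_measurable (lebesgue_on U)"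
  shows "Lp_norm p U f = Lp_norm p U g"
proof -
  have "(\<integral>x. norm (f x) powr p \<partial>lebesgue_on U) = (\<integral>x. norm (g x) powr p \<partial>lebesgue_on U)"
    using assms by (intro integral_cong_AE) (measurable, auto elim!: eventually_mono)
  then show ?thesis by (simp add: Lp_norm_def)
qed

lemma Lp_norm_nonneg: "0 \<le> Lp_norm p U f"
  by (simp add: Lp_norm_def)

text \<open>For \<open>f\<close> and the divergence, the factor \<open>r\<^sup>2\<close> and the
  root of the Jacobian combine to the exponent \<open>2 - m / q\<close>. In the freezing term the
  Hoelder bound gives \<open>r powr \<gamma>\<^sub>0\<close> and the gradient norm
  \<open>r powr (1 - m / 2)\<close>. Here \<open>m\<close> is \<open>CARD('m)\<close>.\<close>

lemma oscillation_decay_rescaled: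
  fixes S :: "('m::finite, 'k::finite) quadruple set"
  assumes S: "S \<subseteq> admissible_quadruples q ell \<Lambda> \<gamma>\<^sub>0" "closed_under_rescaling S"
      "oscillation_decay q \<theta> \<gamma> p M \<kappa> S"
    and Q: "(u, \<Omega>, f, A) \<in> S" "Linf_norm (ball 0 1) u \<le> M"
    and G: "has_L2_gradient u G (ball 0 1)" and d: "has_Lq_divergence q \<Omega> d (ball 0 1)"
    and r: "r > 0" "ball x0 r \<subseteq> ball 0 1"
    and par: "\<theta> > 0" "\<theta> < 1" "p \<ge> 1" "M > 0" "\<kappa> > 0" "q > 0" "\<gamma>\<^sub>0 > 0"
  shows "oscillation p u (ball x0 (r * \<theta>)) \<le> \<gamma> * oscillation p u (ball x0 r)
    + \<kappa> * ((r powr (2 - real CARD('m) / q) * (Lp_norm q (ball 0 1) f + M * Lp_norm q (ball 0 1) d)) powr p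
      + (r powr (\<gamma>\<^sub>0 + (2 - real CARD('m)) / 2)
         * (enn2real (holder_seminorm \<gamma>\<^sub>0 (cball 0 1) A) * Lp_norm 2 (ball 0 1) G)) powr p)"
proof -
  let ?B = "ball 0 1 :: (real^'m) set"
  let ?T = "\<lambda>y. x0 + r *\<^sub>R y"
  let ?m = "real CARD('m)"
  let ?H = "enn2real (holder_seminorm \<gamma>\<^sub>0 (cball 0 1) A)"
  from S(2) Q(1) r obtain Q' where Q': "Q' \<in> S" "same_quadruple (rescale x0 r (u, \<Omega>, f, A)) Q'"
    unfolding closed_under_rescaling_def by blast
  obtain u' \<Omega>' f' A' where Q'_eq: "Q' = (u', \<Omega>', f', A')" by (cases Q')
  have u': "AE y in lebesgue_on ?B. u (?T y) = u' y"
    and Om': "AE y in lebesgue_on ?B. r *\<^sub>R \<Omega> (?T y) = \<Omega>' y"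
    and f': "AE y in lebesgue_on ?B. r\<^sup>2 *\<^sub>R f (?T y) = f' y"
    and A': "\<And>y. y \<in> cball 0 1 \<Longrightarrow> A (?T y) = A' y"
    using Q'(2) by (auto simp: same_quadruple_def rescale_def Q'_eq)
  have adm: "(u, \<Omega>, f, A) \<in> admissible_quadruples q ell \<Lambda> \<gamma>\<^sub>0" using S(1) Q(1) by blast
  have adm': "(u', \<Omega>', f', A') \<in> admissible_quadruples q ell \<Lambda> \<gamma>\<^sub>0" using S(1) Q'(1) Q'_eq by blast
  note m = admissible_measurable[OF adm par(7)]
  note m' = admissible_measurable[OF adm' par(7)]
  have mT: "(\<lambda>y. g (?T y)) \<in> borel_measurable (lebesgue_on ?B)"
    if "g \<in> borel_measurable (lebesgue_on ?B)" for g :: "real^'m \<Rightarrow> 'b::euclidean_space"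
  proof (rule measurable_ball_affine[OF r(1)])
    show "g \<in> borel_measurable (lebesgue_on (ball x0 (r * 1)))"
      using measurable_restrict_mono[OF that r(2)] by simp
  qed
  have muT: "(\<lambda>y. u (?T y)) \<in> borel_measurable (lebesgue_on ?B)" by (rule mT[OF m(1)])
  have mOT: "(\<lambda>y. r *\<^sub>R \<Omega> (?T y)) \<in> borel_measurable (lebesgue_on ?B)"
    by (rule borel_measurable_scaleR[OF borel_measurable_const mT[OF m(2)]])
  have mfT: "(\<lambda>y. r\<^sup>2 *\<^sub>R f (?T y)) \<in> borel_measurable (lebesgue_on ?B)"
    by (rule borel_measurable_scaleR[OF borel_measurable_const mT[OF m(3)]])
  define G' where "G' y = r *\<^sub>R G (?T y)" for y
  define d' where "d' y = r\<^sup>2 *\<^sub>R d (?T y)" for y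
  have GL: "G \<in> Lp_space 2 ?B" using G unfolding has_L2_gradient_def by blast
  have dL: "d \<in> Lp_space q ?B" using d unfolding has_Lq_divergence_def by blast
  have fL: "f \<in> Lp_space q ?B" using adm unfolding admissible_quadruples_def by blast
  have G': "has_L2_gradient u' G' ?B"
    unfolding G'_def by (rule has_L2_gradient_cong_AE[OF has_L2_gradient_scale[OF G r m(1)] u' muT m'(1)])
  have d': "has_Lq_divergence q \<Omega>' d' ?B"
    unfolding d'_def by (rule has_Lq_divergence_cong_AE[OF has_Lq_divergence_scale[OF d r par(6) m(2)] Om' mOT m'(2)])
  have uL: "u \<in> Linf_space ?B" using adm unfolding admissible_quadruples_def by blast
  have bu: "AE x in lebesgue_on ?B. norm (u x) \<le> M"
    using AE_le_Linf_norm[OF uL] by eventually_elim (use Q(2) in linarith)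
  have "AE x in lebesgue_on (ball x0 (r * 1)). norm (u x) \<le> M"
    unfolding mult_1_right by (rule AE_lebesgue_on_subset[OF bu r(2)]) simp_all
  then have "AE y in lebesgue_on ?B. norm (u (?T y)) \<le> M" by (rule AE_ball_affine[OF r(1)])
  then have bu': "AE y in lebesgue_on ?B. norm (u' y) \<le> M"
    using u' by eventually_elim simp
  have Linf': "Linf_norm ?B u' \<le> M"
    by (rule Linf_norm_le[OF m'(1) bu' less_imp_le[OF par(4)]])
  define Ds where "Ds = Lp_norm q ?B f' + M * Lp_norm q ?B d'"
  define Df where "Df = Linf_norm ?B (\<lambda>x. A' x - A' 0) * Lp_norm 2 ?B G'"
  \<comment> \<open>The decay hypothesis holds for every choice of weak gradient and divergence, so
    it may be applied with the rescaled ones.\<close>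
  have main: "oscillation p u' (ball 0 \<theta>) \<le> \<gamma> * oscillation p u' ?B + \<kappa> * (Ds powr p + Df powr p)"
    using S(3) Q'(1) G' d' Linf' unfolding oscillation_decay_def Q'_eq Ds_def Df_def Let_def by blast
  have osc: "oscillation p u' (ball 0 s) = oscillation p u (ball x0 (r * s))" if s: "0 < s" "s \<le> 1" for s
  proof -
    have sub: "ball 0 s \<subseteq> ?B" using s by (intro subset_ball)
    have sub2: "ball x0 (r * s) \<subseteq> ?B" using s r subset_ball[of "r * s" r x0] by auto
    have "oscillation p (\<lambda>y. u (?T y)) (ball 0 s) = oscillation p u' (ball 0 s)"
      by (rule oscillation_cong_AE[OF AE_lebesgue_on_subset[OF u' sub] measurable_restrict_mono[OF muT sub]
            measurable_restrict_mono[OF m'(1) sub]]) simp_all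
    moreover have "oscillation p (\<lambda>y. u (?T y)) (ball 0 s) = oscillation p u (ball x0 (r * s))"
      by (rule oscillation_scale[OF r(1) s(1) measurable_restrict_mono[OF m(1) sub2]])
    ultimately show ?thesis by simp
  qed
  have r2: "r\<^sup>2 * r powr (- (?m / q)) = r powr (2 - ?m / q)"
    using r(1) by (simp add: powr_add[symmetric] flip: powr_numeral)
  have "Lp_norm q ?B f' = Lp_norm q ?B (\<lambda>y. r\<^sup>2 *\<^sub>R f (?T y))"
    by (rule Lp_norm_cong_AE[OF f' mfT m'(3), symmetric])
  also have "\<dots> \<le> r powr (2 - ?m / q) * Lp_norm q ?B f"
    using Lp_space_scale(2)[OF fL r par(6), of "r\<^sup>2"] by (simp add: r2 del: norm_scaleR)
  finally have 1: "Lp_norm q ?B f' \<le> r powr (2 - ?m / q) * Lp_norm q ?B f" .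
  have 2: "Lp_norm q ?B d' \<le> r powr (2 - ?m / q) * Lp_norm q ?B d"
    using Lp_space_scale(2)[OF dL r par(6), of "r\<^sup>2"] by (simp add: r2 d'_def[abs_def] del: norm_scaleR)
  have "Ds \<le> r powr (2 - ?m / q) * Lp_norm q ?B f + M * (r powr (2 - ?m / q) * Lp_norm q ?B d)"
    unfolding Ds_def using 1 2 par by (intro add_mono mult_left_mono) auto
  then have Ds: "Ds \<le> r powr (2 - ?m / q) * (Lp_norm q ?B f + M * Lp_norm q ?B d)"
    by (simp add: algebra_simps)
  have Ds0: "Ds \<ge> 0" unfolding Ds_def using par by (intro add_nonneg_nonneg mult_nonneg_nonneg Lp_norm_nonneg) auto
  have hol: "holder_seminorm \<gamma>\<^sub>0 (cball 0 1) A < \<infinity>" using adm unfolding admissible_quadruples_def by blast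
  have mA: "(\<lambda>x. A' x - A' 0) \<in> borel_measurable (lebesgue_on ?B)"
    by (intro borel_measurable_diff m'(4) borel_measurable_const)
  \<comment> \<open>The Hoelder bound for \<open>A\<close> is available only on the closed unit
    ball, so the rescaled points must be located there.\<close>
  have cb: "?T y \<in> cball 0 1" if "y \<in> ?B" for y
  proof -
    have "?T y \<in> ball x0 r" using that r(1) by (simp add: dist_norm)
    then have "?T y \<in> ?B" using r(2) by (rule subsetD[rotated])
    then show ?thesis by simp
  qed
  have Linf: "Linf_norm ?B (\<lambda>x. A' x - A' 0) \<le> ?H * r powr \<gamma>\<^sub>0"
  proof (rule Linf_norm_le[OF mA])
    have "norm (A' y - A' 0) \<le> ?H * r powr \<gamma>\<^sub>0" if y: "y \<in> ?B" for y
    proof -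
      have "norm (A' y - A' 0) = dist (A (?T y)) (A (?T 0))"
        using y A'[of y] A'[of 0] by (simp add: dist_norm)
      also have "\<dots> \<le> ?H * dist (?T y) (?T 0) powr \<gamma>\<^sub>0"
        by (rule holder_seminormD[OF hol cb[OF y] cb]) simp
      also have "\<dots> \<le> ?H * r powr \<gamma>\<^sub>0"
        using y r(1) par by (intro mult_left_mono powr_mono2) (auto simp: dist_norm mult_le_cancel_left1)
      finally show ?thesis .
    qed
    then show "AE y in lebesgue_on ?B. norm (A' y - A' 0) \<le> ?H * r powr \<gamma>\<^sub>0"
      by (intro AE_I2) simp
  qed simp
  have LG: "Lp_norm 2 ?B G' \<le> r powr (1 - ?m / 2) * Lp_norm 2 ?B G"
  proof -
    have "r * r powr (- (?m / 2)) = r powr (1 - ?m / 2)"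
      using r(1) powr_add[of r 1 "- (?m / 2)"] by simp
    then show ?thesis
      using Lp_space_scale(2)[OF GL r, of r] r(1) by (simp add: G'_def[abs_def] del: norm_scaleR)
  qed
  have "Df \<le> (?H * r powr \<gamma>\<^sub>0) * (r powr (1 - ?m / 2) * Lp_norm 2 ?B G)"
    unfolding Df_def by (intro mult_mono Linf LG mult_nonneg_nonneg Lp_norm_nonneg) auto
  also have "\<dots> = r powr (\<gamma>\<^sub>0 + (2 - ?m) / 2) * (?H * Lp_norm 2 ?B G)"
    by (simp add: powr_add diff_divide_distrib mult_ac)
  finally have Df: "Df \<le> r powr (\<gamma>\<^sub>0 + (2 - ?m) / 2) * (?H * Lp_norm 2 ?B G)" .
  have Df0: "Df \<ge> 0" unfolding Df_def by (intro mult_nonneg_nonneg Lp_norm_nonneg Linf_norm_nonneg mA)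
  have fin: "\<kappa> * (Ds powr p + Df powr p)
    \<le> \<kappa> * ((r powr (2 - ?m / q) * (Lp_norm q ?B f + M * Lp_norm q ?B d)) powr p
      + (r powr (\<gamma>\<^sub>0 + (2 - ?m) / 2) * (?H * Lp_norm 2 ?B G)) powr p)"
    using Ds Ds0 Df Df0 par by (intro mult_left_mono add_mono powr_mono2) auto
  have "oscillation p u' (ball 0 \<theta>) = oscillation p u (ball x0 (r * \<theta>))"
    "oscillation p u' ?B = oscillation p u (ball x0 r)"
    using osc[of \<theta>] osc[of 1] par by simp_all
  then show ?thesis using order_trans[OF main add_left_mono[OF fin]] by simp
qed

section \<open>Explicit constants and the Hoelder bound\<close>

text \<open>The constant of \<open>geometric_decay_bound\<close> for
  \<open>\<Psi> = M powr p\<close> and \<open>e = p * \<eta>\<close>, with \<open>b\<close>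
  collecting the source and freezing terms at radius \<open>1\<close>.\<close>

definition oscillation_constant :: "real \<Rightarrow> real \<Rightarrow> real \<Rightarrow> real \<Rightarrow> real \<Rightarrow> real \<Rightarrow> real \<Rightarrow> real \<Rightarrow> real \<Rightarrow> real \<Rightarrow> real \<Rightarrow> real"
  where "oscillation_constant \<eta> \<theta> \<gamma> \<kappa> p M Ld Lf LG H R =
    (M powr p + \<kappa> * ((Lf + M * Ld) powr p + (H * LG) powr p) / (\<theta> powr (p * \<eta>) - \<gamma>) + 1)
      * (\<theta> * R) powr (- (p * \<eta>))"

text \<open>The constant of \<open>campanato\<close> with \<open>P\<close> written out. The
  dimension is a number here, so that the witness of the theorem is visibly a function of the listed
  quantities alone.\<close>

definition campanato_constant :: "nat \<Rightarrow> real \<Rightarrow> real \<Rightarrow> real \<Rightarrow> real \<Rightarrow> real"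
  where "campanato_constant D \<eta> M L R =
    2 * (1 + unit_ball_vol (real D) * L / (1 / (2 * (real D + 3))) ^ D) * (real D + 3) powr \<eta>
      * (1 + 2 / (1 - (1 / 2) powr \<eta>)) + 2 * M * ((real D + 3) / R) powr \<eta>"

text \<open>Multiplying by the negative number \<open>p * ln \<theta>\<close> reverses the bound on
  \<open>\<eta>\<close>. The resulting gap is the denominator
  \<open>\<theta> powr (p * \<eta>) - \<gamma>\<close> of the iteration constant.\<close>

lemma powr_le_powr_of_less:
  fixes \<theta> \<gamma> p \<eta> :: real
  assumes "0 < \<theta>" "\<theta> < 1" "0 < \<gamma>" "p \<ge> 1" "\<eta> < ln \<gamma> / (p * ln \<theta>)"
  shows "\<gamma> < \<theta> powr (p * \<eta>)"
proof -
  have "p * ln \<theta> < 0" using assms by (intro mult_pos_neg) auto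
  then have "ln \<gamma> < \<eta> * (p * ln \<theta>)" using assms(5) by (simp add: neg_less_divide_eq)
  then have "exp (ln \<gamma>) < exp (p * \<eta> * ln \<theta>)" by (simp add: mult_ac)
  then show ?thesis using assms by (simp add: powr_def)
qed

lemma cube_limit_holder:
  fixes S :: "('m::finite, 'k::finite) quadruple set"
  assumes S: "S \<subseteq> admissible_quadruples q ell \<Lambda> \<gamma>\<^sub>0" "closed_under_rescaling S"
      "oscillation_decay q \<theta> \<gamma> p M \<kappa> S"
    and Q: "(u, \<Omega>, f, A) \<in> S" "Linf_norm (ball 0 1) u \<le> M"
    and G: "has_L2_gradient u G (ball 0 1)" and d: "has_Lq_divergence q \<Omega> d (ball 0 1)"
    and par: "\<theta> > 0" "\<theta> < 1" "p \<ge> 1" "M > 0" "\<kappa> > 0" "q > 0" "\<gamma>\<^sub>0 > 0"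
    and \<gamma>: "0 < \<gamma>" "\<gamma> < 1"
    and \<eta>: "0 < \<eta>" "\<eta> < ln \<gamma> / (p * ln \<theta>)" "\<eta> < 2 - real CARD('m) / q"
      "\<eta> < \<gamma>\<^sub>0 + (2 - real CARD('m)) / 2"
    and K: "compact K" "K \<subseteq> ball 0 1"
  shows "holder_seminorm \<eta> K (cube_limit u) \<le> ennreal (campanato_constant CARD('m) \<eta> M
    (oscillation_constant \<eta> \<theta> \<gamma> \<kappa> p M (Lp_norm q (ball 0 1) d) (Lp_norm q (ball 0 1) f)
       (Lp_norm 2 (ball 0 1) G) (enn2real (holder_seminorm \<gamma>\<^sub>0 (cball 0 1) A)) (setdist K (frontier (ball 0 1))))
    (setdist K (frontier (ball 0 1))))"
proof (cases "K = {}")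
  \<comment> \<open>For empty \<open>K\<close> the distance to the frontier is \<open>0\<close> by
    convention, so there is no positive radius to work with; the seminorm is \<open>0\<close> as a
    supremum over the empty set.\<close>
  case True
  then show ?thesis by (simp add: holder_seminorm_def bot_ennreal)
next
  case False
  define B :: "(real^'m) set" where "B = ball 0 1"
  define R where "R = setdist K (frontier B)"
  define X where "X = Lp_norm q B f + M * Lp_norm q B d"
  define Y where "Y = enn2real (holder_seminorm \<gamma>\<^sub>0 (cball 0 1) A) * Lp_norm 2 B G"
  define b where "b = \<kappa> * (X powr p + Y powr p)"
  define L where "L = (M powr p + b / (\<theta> powr (p * \<eta>) - \<gamma>) + 1) * (\<theta> * R) powr (- (p * \<eta>))"
  have X: "X \<ge> 0" unfolding X_def using par by (intro add_nonneg_nonneg mult_nonneg_nonneg Lp_norm_nonneg) auto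
  have Y: "Y \<ge> 0" unfolding Y_def by (intro mult_nonneg_nonneg Lp_norm_nonneg) auto
  have b: "b \<ge> 0" unfolding b_def using par by simp
  have fr: "frontier B = sphere 0 1" by (simp add: B_def)
  have "sphere 0 1 \<noteq> ({} :: (real^'m) set)" by simp
  moreover have "K \<inter> sphere 0 1 = {}" using K(2) by (auto simp: subset_iff)
  ultimately have R0: "R > 0"
    unfolding R_def fr using setdist_gt_0_compact_closed[OF K(1) closed_sphere] False by blast
  have balls: "ball x R \<subseteq> B" if "x \<in> K" for x
    unfolding R_def using that K(2) by (intro ball_setdist_frontier_subset) (auto simp: B_def)
  have R1: "R \<le> 1"
  proof -
    obtain x where "x \<in> K" using False by blast
    from balls[OF this] R0 have "dist x 0 + R \<le> 1" unfolding B_def ball_subset_ball_iff by simp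
    then show ?thesis using zero_le_dist[of x 0] by linarith
  qed
  have adm: "(u, \<Omega>, f, A) \<in> admissible_quadruples q ell \<Lambda> \<gamma>\<^sub>0" using S(1) Q(1) by blast
  have um: "u \<in> borel_measurable (lebesgue_on B)"
    unfolding B_def by (rule admissible_measurable(1)[OF adm par(7)])
  have uL: "u \<in> Linf_space B" using adm unfolding admissible_quadruples_def B_def by blast
  have bu: "AE x in lebesgue_on B. norm (u x) \<le> M"
    using AE_le_Linf_norm[OF uL] by eventually_elim (use Q(2) in \<open>simp add: B_def\<close>)
  have gam: "\<gamma> < \<theta> powr (p * \<eta>)" by (rule powr_le_powr_of_less[OF par(1,2) \<gamma>(1) par(3) \<eta>(2)])
  have L0: "L \<ge> 0" unfolding L_def using gam b by (intro mult_nonneg_nonneg add_nonneg_nonneg) auto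
  have osc: "oscillation p u (ball x r) < L * r powr (p * \<eta>)" if x: "x \<in> K" and r: "0 < r" "r \<le> R" for x r
    unfolding L_def
  proof (rule geometric_decay_bound[where \<psi> = "\<lambda>r. oscillation p u (ball x r)"])
    fix s assume s: "0 < s" "s \<le> R"
    have sub: "ball x s \<subseteq> B" using balls[OF x] subset_ball[OF s(2), of x] by blast
    show "oscillation p u (ball x s) \<le> M powr p"
    proof (rule oscillation_bounded)
      show "measure lebesgue (ball x s) > 0" using s by (simp add: measure_completion)
      show "u \<in> borel_measurable (lebesgue_on (ball x s))" by (rule measurable_restrict_mono[OF um sub])
      show "AE x in lebesgue_on (ball x s). norm (u x) \<le> M"
        by (rule AE_lebesgue_on_subset[OF bu sub]) (auto simp: B_def)
    qed (use par in auto)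
    \<comment> \<open>As \<open>s \<le> R \<le> 1\<close>, larger exponents give smaller powers, so
      the source and freezing terms are both absorbed into
      \<open>s powr (p * \<eta>)\<close>.\<close>
    have scale: "(s powr a * Z) powr p \<le> Z powr p * s powr (p * \<eta>)" if "\<eta> < a" "Z \<ge> 0" for a Z
    proof -
      have "(s powr a * Z) powr p = Z powr p * s powr (p * a)"
        using that by (simp add: powr_mult powr_powr mult_ac)
      also have "\<dots> \<le> Z powr p * s powr (p * \<eta>)"
        using that s R1 par by (intro mult_left_mono powr_mono') auto
      finally show ?thesis .
    qed
    have "oscillation p u (ball x (s * \<theta>)) \<le> \<gamma> * oscillation p u (ball x s)
      + \<kappa> * ((s powr (2 - real CARD('m) / q) * X) powr p + (s powr (\<gamma>\<^sub>0 + (2 - real CARD('m)) / 2) * Y) powr p)"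
      unfolding X_def Y_def B_def
      by (rule oscillation_decay_rescaled[OF S Q G d s(1) sub[unfolded B_def] par])
    also have "\<dots> \<le> \<gamma> * oscillation p u (ball x s)
      + \<kappa> * (X powr p * s powr (p * \<eta>) + Y powr p * s powr (p * \<eta>))"
      using par by (intro add_left_mono mult_left_mono add_mono scale \<eta> X Y) auto
    also have "\<dots> = \<gamma> * oscillation p u (ball x s) + b * s powr (p * \<eta>)"
      by (simp add: b_def algebra_simps)
    finally show "oscillation p u (ball x (s * \<theta>)) \<le> \<gamma> * oscillation p u (ball x s) + b * s powr (p * \<eta>)" .
  qed (use par R0 R1 \<eta> \<gamma> gam b r in auto)
  have "dist (cube_limit u x) (cube_limit u y) \<le> campanato_constant CARD('m) \<eta> M L R * dist x y powr \<eta>"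
    if xy: "x \<in> K" "y \<in> K" for x y
  proof -
    have D: "DIM(real^'m) = CARD('m)" by simp
    show ?thesis
      unfolding campanato_constant_def
      by (rule campanato[where 'a = "real^'m", unfolded D, OF um[unfolded B_def] bu[unfolded B_def]
            less_imp_le[OF par(4)] par(3) \<eta>(1) L0 R0 balls[unfolded B_def] osc xy])
  qed
  then have "holder_seminorm \<eta> K (cube_limit u) \<le> ennreal (campanato_constant CARD('m) \<eta> M L R)"
    by (rule holder_seminorm_leI)
  then show ?thesis
    by (simp only: L_def b_def X_def Y_def R_def B_def oscillation_constant_def)
qed

theorem theorem5p6:
  fixes m n :: nat and q ell \<Lambda> \<gamma>\<^sub>0 :: real
  assumes "CARD('m::finite) = m" and "CARD('k::finite) = n + 1"
    and "m \<ge> 2" and "n \<ge> 1" and "q > real m / 2"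
    and "0 < ell" and "ell \<le> \<Lambda>"
    and "0 < \<gamma>\<^sub>0" and "\<gamma>\<^sub>0 \<le> 1" and "\<gamma>\<^sub>0 > (real m - 2) / 2"
  shows "\<exists>C :: real \<Rightarrow> real \<Rightarrow> real \<Rightarrow> real \<Rightarrow> real \<Rightarrow> real \<Rightarrow> real \<Rightarrow> real \<Rightarrow> real \<Rightarrow> real \<Rightarrow> real \<Rightarrow> real.
    \<forall>(S :: ('m, 'k) quadruple set) \<theta> \<gamma> p M \<kappa>.
      S \<subseteq> admissible_quadruples q ell \<Lambda> \<gamma>\<^sub>0 \<and>
      closed_under_rescaling S \<and>
      0 < \<theta> \<and> \<theta> < 1 \<and> 0 < \<gamma> \<and> \<gamma> < 1 \<and> p \<ge> 1 \<and> M > 0 \<and> \<kappa> > 0 \<and>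
      oscillation_decay q \<theta> \<gamma> p M \<kappa> S \<longrightarrow>
      (\<forall>(u, \<Omega>, f, A)\<in>S. Linf_norm (ball 0 1) u \<le> M \<longrightarrow>
        (\<exists>v. (AE x in lebesgue_on (ball 0 1). v x = u x) \<and>
          (\<forall>\<eta>. 0 < \<eta> \<and> \<eta> < 1 \<and>
             \<eta> < Min {ln \<gamma> / (p * ln \<theta>), 2 - real m / q, \<gamma>\<^sub>0 + (2 - real m) / 2} \<longrightarrow>
             locally_holder \<eta> (ball 0 1) v \<and>
             (\<forall>K G d. compact K \<and> K \<subseteq> ball 0 1 \<and>
                has_L2_gradient u G (ball 0 1) \<and> has_Lq_divergence q \<Omega> d (ball 0 1) \<longrightarrow>
                holder_seminorm \<eta> K v \<le> ennreal
                  (C \<eta> \<theta> \<gamma> \<kappa> p M (Lp_norm q (ball 0 1) d) (Lp_norm q (ball 0 1) f)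
                     (Lp_norm 2 (ball 0 1) G) (enn2real (holder_seminorm \<gamma>\<^sub>0 (cball 0 1) A))
                     (setdist K (frontier (ball 0 1))))))))"
proof (rule exI[of _ "\<lambda>\<eta> \<theta> \<gamma> \<kappa> p M Ld Lf LG H R.
    campanato_constant CARD('m) \<eta> M (oscillation_constant \<eta> \<theta> \<gamma> \<kappa> p M Ld Lf LG H R) R"],
    intro allI impI ballI, clarify)
  fix S :: "('m, 'k) quadruple set" and \<theta> \<gamma> p M \<kappa> u \<Omega> f A
  assume S: "S \<subseteq> admissible_quadruples q ell \<Lambda> \<gamma>\<^sub>0" "closed_under_rescaling S"
      "oscillation_decay q \<theta> \<gamma> p M \<kappa> S"
    and \<theta>: "0 < \<theta>" "\<theta> < 1" and \<gamma>: "0 < \<gamma>" "\<gamma> < 1" and p: "1 \<le> p" and M: "0 < M" and \<kappa>: "0 < \<kappa>"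
    and Q: "(u, \<Omega>, f, A) \<in> S" "Linf_norm (ball 0 1) u \<le> M"
  have q: "q > 0" using assms by (smt (verit) divide_nonneg_nonneg of_nat_0_le_iff)
  have adm: "(u, \<Omega>, f, A) \<in> admissible_quadruples q ell \<Lambda> \<gamma>\<^sub>0" using S(1) Q(1) by blast
  then have uL: "u \<in> Linf_space (ball 0 1)" unfolding admissible_quadruples_def by blast
  obtain G where G: "has_L2_gradient u G (ball 0 1)"
    using adm unfolding admissible_quadruples_def H1_space_def by blast
  obtain d where d: "has_Lq_divergence q \<Omega> d (ball 0 1)"
    using adm unfolding admissible_quadruples_def by blast
  \<comment> \<open>\<open>G\<close> and \<open>d\<close> are generalised here: the bound has to
    hold for all representatives of the weak derivatives, with the same limit function
    throughout.\<close>
  have bound: "holder_seminorm \<eta> K (cube_limit u) \<le> ennreal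
      (campanato_constant CARD('m) \<eta> M (oscillation_constant \<eta> \<theta> \<gamma> \<kappa> p M
        (Lp_norm q (ball 0 1) d) (Lp_norm q (ball 0 1) f) (Lp_norm 2 (ball 0 1) G)
        (enn2real (holder_seminorm \<gamma>\<^sub>0 (cball 0 1) A)) (setdist K (frontier (ball 0 1))))
        (setdist K (frontier (ball 0 1))))"
    if "0 < \<eta>" "\<eta> < Min {ln \<gamma> / (p * ln \<theta>), 2 - real m / q, \<gamma>\<^sub>0 + (2 - real m) / 2}"
      and "compact K" "K \<subseteq> ball 0 1"
      and "has_L2_gradient u G (ball 0 1)" "has_Lq_divergence q \<Omega> d (ball 0 1)" for \<eta> K G d
    using that by (intro cube_limit_holder[OF S Q that(5,6) \<theta> p M \<kappa> q assms(8) \<gamma>]) (auto simp: assms(1))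
  show "\<exists>v. (AE x in lebesgue_on (ball 0 1). v x = u x) \<and>
          (\<forall>\<eta>. 0 < \<eta> \<and> \<eta> < 1 \<and>
             \<eta> < Min {ln \<gamma> / (p * ln \<theta>), 2 - real m / q, \<gamma>\<^sub>0 + (2 - real m) / 2} \<longrightarrow>
             locally_holder \<eta> (ball 0 1) v \<and>
             (\<forall>K G d. compact K \<and> K \<subseteq> ball 0 1 \<and>
                has_L2_gradient u G (ball 0 1) \<and> has_Lq_divergence q \<Omega> d (ball 0 1) \<longrightarrow>
                holder_seminorm \<eta> K v \<le> ennreal
                  (campanato_constant CARD('m) \<eta> M (oscillation_constant \<eta> \<theta> \<gamma> \<kappa> p M
                     (Lp_norm q (ball 0 1) d) (Lp_norm q (ball 0 1) f)
                     (Lp_norm 2 (ball 0 1) G) (enn2real (holder_seminorm \<gamma>\<^sub>0 (cball 0 1) A))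
                     (setdist K (frontier (ball 0 1)))) (setdist K (frontier (ball 0 1))))))"
  proof (intro exI[of _ "cube_limit u"] conjI allI impI)
    show "AE x in lebesgue_on (ball 0 1). cube_limit u x = u x"
      by (rule cube_limit_eq_AE[OF admissible_measurable(1)[OF adm assms(8)] AE_le_Linf_norm[OF uL]])
  next
    fix \<eta>
    assume \<eta>: "0 < \<eta> \<and> \<eta> < 1 \<and>
      \<eta> < Min {ln \<gamma> / (p * ln \<theta>), 2 - real m / q, \<gamma>\<^sub>0 + (2 - real m) / 2}"
    show "locally_holder \<eta> (ball 0 1) (cube_limit u)"
      unfolding locally_holder_def
    proof (intro allI impI)
      \<comment> \<open>Local Hoelder continuity mentions no derivatives, so the pair
        \<open>G\<close>, \<open>d\<close> supplied by admissibility is inserted into the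
        bound.\<close>
      fix K assume "compact K \<and> K \<subseteq> ball (0 :: real^'m) 1"
      then show "holder_seminorm \<eta> K (cube_limit u) < \<infinity>"
        using bound[of \<eta> K G d] \<eta> G d by (simp add: le_less_trans[OF _ ennreal_less_top])
    qed
  qed (use bound in blast)
qed

end
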